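(* Let $I\subset R$ be an ideal in a Noetherian ring $R$. Then $\sqrt{I}\subseteq\sqrt{C(I)}$.
   Context: All rings are commutative with unit. For a Noetherian ring $R$ and an ideal $I=(f_1,\ldots,f_m)\subseteq R$, let $\mathcal{R}(I)=R[f_1t,\ldots,f_mt]\subseteq R[t]$ be the Rees algebra, $T=R[y_1,\ldots,y_m]$ a polynomial ring, $\varphi:T\to\mathcal{R}(I)$ the $R$-algebra homomorphism with $\varphi(y_j)=f_jt$, and $J=\ker\varphi$. Let $L\subseteq J$ be the ideal of $T$ generated by all linear relations $\sum_{i=1}^m a_iy_i$ with $a_i\in R$ and $\sum_i a_if_i=0$. Then $T/L\cong S(I)$ is the symmetric algebra of $I$, and the kernel of the canonical epimorphism $\alpha:S(I)\to\mathcal{R}(I)$ is $J/L$. The conductor of $I$ is the ideal $C(I)=L:_RJ=\{r\in R: rJ\subseteq L\}=\mathrm{Ann}_R(\ker\alpha)$ of $R$; it does not depend on the chosen generators. *)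

theory Defs
  imports "HOL-Algebra.Algebra"
begin

definition radical :: "('a, 'b) ring_scheme \<Rightarrow> 'a set \<Rightarrow> 'a set" where
  "radical R I = {x \<in> carrier R. \<exists>n::nat. x [^]\<^bsub>R\<^esub> n \<in> I}"

text \<open>The ring \<open>T = R[y\<^sub>0, \<dots>, y\<^sub>m\<^sub>-\<^sub>1]\<close>. Elements are the indexed polynomials of
  \<^theory>\<open>HOL-Algebra.Indexed_Polynomials\<close>: coefficient functions on monomials, a monomial being
  the multiset of its variables. That theory provides addition and multiplication by a single
  variable only, so the product (convolution) is added here.\<close>

definition mpoly_ring :: "('a, 'b) ring_scheme \<Rightarrow> nat \<Rightarrow> (nat multiset \<Rightarrow> 'a) ring" where
  "mpoly_ring R m =
    \<lparr> carrier = ring.indexed_pset R {..<m} (carrier R),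
      monoid.mult = (\<lambda>F G \<mu>. \<Oplus>\<^bsub>R\<^esub>\<nu>\<in>{\<nu>. \<nu> \<subseteq># \<mu>}. F \<nu> \<otimes>\<^bsub>R\<^esub> G (\<mu> - \<nu>)),
      monoid.one = ring.indexed_const R \<one>\<^bsub>R\<^esub>,
      ring.zero = ring.indexed_const R \<zero>\<^bsub>R\<^esub>,
      ring.add = ring.indexed_padd R \<rparr>"

text \<open>\<open>R[f\<^sub>0 t, \<dots>, f\<^sub>m\<^sub>-\<^sub>1 t]\<close> as a subring of \<open>R[t] = UP R\<close>.\<close>

definition rees_algebra ::
    "('a, 'b) ring_scheme \<Rightarrow> nat \<Rightarrow> (nat \<Rightarrow> 'a) \<Rightarrow> ('a, nat \<Rightarrow> 'a) up_ring" where
  "rees_algebra R m f = (UP R)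
    \<lparr> carrier := generate_ring (UP R)
        ({monom (UP R) a 0 | a. a \<in> carrier R} \<union> {monom (UP R) (f j) 1 | j. j < m}) \<rparr>"

text \<open>The \<open>R\<close>-algebra homomorphism \<open>\<phi> : T \<rightarrow> \<R>(I)\<close> with \<open>\<phi>(y\<^sub>j) = f\<^sub>j t\<close>, written out as
  evaluation at \<open>(f\<^sub>0 t, \<dots>, f\<^sub>m\<^sub>-\<^sub>1 t)\<close>.\<close>

definition rees_hom ::
    "('a, 'b) ring_scheme \<Rightarrow> (nat \<Rightarrow> 'a) \<Rightarrow> (nat multiset \<Rightarrow> 'a) \<Rightarrow> (nat \<Rightarrow> 'a)" where
  "rees_hom R f F =
    (\<Oplus>\<^bsub>UP R\<^esub>\<mu>\<in>{\<mu>. F \<mu> \<noteq> \<zero>\<^bsub>R\<^esub>}. monom (UP R) (F \<mu>) 0 \<otimes>\<^bsub>UP R\<^esub>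
      (\<Otimes>\<^bsub>UP R\<^esub>j\<in>set_mset \<mu>. monom (UP R) (f j) 1 [^]\<^bsub>UP R\<^esub> count \<mu> j))"

definition rees_ideal ::
    "('a, 'b) ring_scheme \<Rightarrow> nat \<Rightarrow> (nat \<Rightarrow> 'a) \<Rightarrow> (nat multiset \<Rightarrow> 'a) set" where
  "rees_ideal R m f = a_kernel (mpoly_ring R m) (rees_algebra R m f) (rees_hom R f)"

definition linear_relations_ideal ::
    "('a, 'b) ring_scheme \<Rightarrow> nat \<Rightarrow> (nat \<Rightarrow> 'a) \<Rightarrow> (nat multiset \<Rightarrow> 'a) set" where
  "linear_relations_ideal R m f =
    Idl\<^bsub>mpoly_ring R m\<^esub>
      {(\<Oplus>\<^bsub>mpoly_ring R m\<^esub>i\<in>{..<m}.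
          ring.indexed_const R (a i) \<otimes>\<^bsub>mpoly_ring R m\<^esub> ring.indexed_var R i) | a.
        a \<in> {..<m} \<rightarrow> carrier R \<and> (\<Oplus>\<^bsub>R\<^esub>i\<in>{..<m}. a i \<otimes>\<^bsub>R\<^esub> f i) = \<zero>\<^bsub>R\<^esub>}"

text \<open>The conductor \<open>L :\<^sub>R J\<close> of the ideal generated by \<open>f\<^sub>0, \<dots>, f\<^sub>m\<^sub>-\<^sub>1\<close>. It depends only on that
  ideal, but is defined here relative to the given generators.\<close>

definition conductor :: "('a, 'b) ring_scheme \<Rightarrow> nat \<Rightarrow> (nat \<Rightarrow> 'a) \<Rightarrow> 'a set" where
  "conductor R m f =
    {r \<in> carrier R. \<forall>F \<in> rees_ideal R m f.
       ring.indexed_const R r \<otimes>\<^bsub>mpoly_ring R m\<^esub> F \<in> linear_relations_ideal R m f}"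

end

theory Submission
  imports Defs
begin

text \<open>Let \<open>g = \<Sum>\<^sub>i a\<^sub>i f\<^sub>i \<in> I\<close> and \<open>h = \<Sum>\<^sub>i a\<^sub>i y\<^sub>i\<close>. Then \<open>g y\<^sub>j - f\<^sub>j h \<in> L\<close> for all \<open>j\<close>, because
  \<open>g f\<^sub>j - f\<^sub>j g = 0\<close>, so modulo \<open>L\<close> every monomial of degree \<open>d\<close> satisfies
  \<open>g\<^sup>d y\<^sup>\<mu> = f\<^sup>\<mu> h\<^sup>d\<close>. If \<open>F \<in> J\<close>, then each homogeneous component of \<open>F\<close> vanishes at \<open>f\<close>, and hence
  \<open>g\<^sup>N F \<in> L\<close> as soon as \<open>N \<ge> deg F\<close>. By Hilbert's basis theorem \<open>T\<close> is Noetherian, so the chain of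
  ideals \<open>L : g\<^sup>N\<close> is stationary; thus one \<open>N\<close> serves all \<open>F \<in> J\<close>, and \<open>g\<^sup>N \<in> C(I)\<close>.\<close>

section \<open>Hilbert's basis theorem\<close>

text \<open>\<open>S\<close> is meant to be generated over the image of \<open>R\<close> by the
  single element \<open>x\<close>, but \<open>h\<close> need not be injective and \<open>x\<close>
  need not be transcendental. One argument thus covers both adjoining a variable and the passage to
  a ring onto which \<open>h\<close> is surjective.\<close>

locale ring_adjoin = ring_hom_cring R S h
  for R (structure) and S (structure) and h +
  fixes x
  assumes x_closed [simp]: "x \<in> carrier S"
begin

text \<open>\<open>polys n\<close> consists of the polynomials in \<open>x\<close> of degree strictly less than \<open>n\<close>.\<close>

primrec polys :: "nat \<Rightarrow> 'c set" where
  "polys 0 = {\<zero>\<^bsub>S\<^esub>}"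
| "polys (Suc n) = {h a \<otimes>\<^bsub>S\<^esub> x [^]\<^bsub>S\<^esub> n \<oplus>\<^bsub>S\<^esub> s | a s. a \<in> carrier R \<and> s \<in> polys n}"

section \<open>Closure properties of polynomial expressions of bounded degree\<close>

lemma polys_SucI:
  "\<lbrakk>a \<in> carrier R; s \<in> polys n\<rbrakk> \<Longrightarrow> h a \<otimes>\<^bsub>S\<^esub> x [^]\<^bsub>S\<^esub> n \<oplus>\<^bsub>S\<^esub> s \<in> polys (Suc n)"
  by auto

lemma polys_SucE:
  assumes "p \<in> polys (Suc n)"
  obtains a s where "a \<in> carrier R" "s \<in> polys n" "p = h a \<otimes>\<^bsub>S\<^esub> x [^]\<^bsub>S\<^esub> n \<oplus>\<^bsub>S\<^esub> s"
  using assms by auto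

declare polys.simps(2) [simp del]

lemma polys_closed: "p \<in> polys n \<Longrightarrow> p \<in> carrier S"
  by (induction n arbitrary: p) (auto elim!: polys_SucE)

lemma zero_in_polys: "\<zero>\<^bsub>S\<^esub> \<in> polys n"
proof (induction n)
  case (Suc n)
  then show ?case using polys_SucI[OF R.zero_closed Suc] by simp
qed simp

lemma polys_mono_Suc: "p \<in> polys n \<Longrightarrow> p \<in> polys (Suc n)"
  using polys_SucI[OF R.zero_closed] by (fastforce dest: polys_closed)

lemma polys_mono: "n \<le> k \<Longrightarrow> p \<in> polys n \<Longrightarrow> p \<in> polys k"
  by (induction k rule: dec_induct) (auto intro: polys_mono_Suc)

lemma polys_add: "\<lbrakk>p \<in> polys n; q \<in> polys n\<rbrakk> \<Longrightarrow> p \<oplus>\<^bsub>S\<^esub> q \<in> polys n"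
proof (induction n arbitrary: p q)
  case (Suc n)
  obtain a s where p: "a \<in> carrier R" "s \<in> polys n" "p = h a \<otimes>\<^bsub>S\<^esub> x [^]\<^bsub>S\<^esub> n \<oplus>\<^bsub>S\<^esub> s"
    using Suc.prems by (auto elim: polys_SucE)
  obtain b t where q: "b \<in> carrier R" "t \<in> polys n" "q = h b \<otimes>\<^bsub>S\<^esub> x [^]\<^bsub>S\<^esub> n \<oplus>\<^bsub>S\<^esub> t"
    using Suc.prems by (auto elim: polys_SucE)
  have eq: "p \<oplus>\<^bsub>S\<^esub> q = h (a \<oplus> b) \<otimes>\<^bsub>S\<^esub> x [^]\<^bsub>S\<^esub> n \<oplus>\<^bsub>S\<^esub> (s \<oplus>\<^bsub>S\<^esub> t)"
    using p q by (simp add: polys_closed S.l_distr S.a_ac)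
  show ?case unfolding eq by (rule polys_SucI) (use p q Suc.IH in auto)
qed simp

lemma polys_smult: "\<lbrakk>r \<in> carrier R; p \<in> polys n\<rbrakk> \<Longrightarrow> h r \<otimes>\<^bsub>S\<^esub> p \<in> polys n"
proof (induction n arbitrary: p)
  case (Suc n)
  obtain a s where p: "a \<in> carrier R" "s \<in> polys n" "p = h a \<otimes>\<^bsub>S\<^esub> x [^]\<^bsub>S\<^esub> n \<oplus>\<^bsub>S\<^esub> s"
    using Suc.prems by (auto elim: polys_SucE)
  have eq: "h r \<otimes>\<^bsub>S\<^esub> p = h (r \<otimes> a) \<otimes>\<^bsub>S\<^esub> x [^]\<^bsub>S\<^esub> n \<oplus>\<^bsub>S\<^esub> h r \<otimes>\<^bsub>S\<^esub> s"
    using p Suc.prems by (simp add: polys_closed S.r_distr S.m_assoc)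
  show ?case unfolding eq by (rule polys_SucI) (use p Suc in auto)
qed simp

lemma polys_minus: "\<lbrakk>p \<in> polys n; q \<in> polys n\<rbrakk> \<Longrightarrow> p \<ominus>\<^bsub>S\<^esub> q \<in> polys n"
  using polys_add[of p n "h (\<ominus> \<one>) \<otimes>\<^bsub>S\<^esub> q"] polys_smult[of "\<ominus> \<one>" q n]
  by (simp add: polys_closed S.minus_eq S.l_minus)

lemma polys_times_x: "p \<in> polys n \<Longrightarrow> x \<otimes>\<^bsub>S\<^esub> p \<in> polys (Suc n)"
proof (induction n arbitrary: p)
  case (Suc n)
  obtain a s where p: "a \<in> carrier R" "s \<in> polys n" "p = h a \<otimes>\<^bsub>S\<^esub> x [^]\<^bsub>S\<^esub> n \<oplus>\<^bsub>S\<^esub> s"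
    using Suc.prems by (auto elim: polys_SucE)
  have eq: "x \<otimes>\<^bsub>S\<^esub> p = h a \<otimes>\<^bsub>S\<^esub> x [^]\<^bsub>S\<^esub> Suc n \<oplus>\<^bsub>S\<^esub> x \<otimes>\<^bsub>S\<^esub> s"
    using p by (simp add: polys_closed S.r_distr S.m_ac)
  show ?case unfolding eq by (rule polys_SucI) (use p Suc in auto)
qed (simp add: polys_mono_Suc)

lemma hom_in_polys: "a \<in> carrier R \<Longrightarrow> h a \<in> polys (Suc 0)"
  using polys_SucI[of a "\<zero>\<^bsub>S\<^esub>" 0] by simp

lemma polys_add_max: "\<lbrakk>p \<in> polys n; q \<in> polys k\<rbrakk> \<Longrightarrow> p \<oplus>\<^bsub>S\<^esub> q \<in> polys (max n k)"
  by (rule polys_add) (auto intro: polys_mono[rotated])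

text \<open>These are the coefficients at \<open>x [^] d\<close> in expressions of degree at most
  \<open>d\<close> that represent an element of \<open>J\<close>. As such expressions need not be
  unique, an element may contribute several coefficients, so the set is described by the existence
  of a tail \<open>s\<close> and not by a leading coefficient function. A vanishing coefficient is
  allowed.\<close>

definition lead_ideal :: "'c set \<Rightarrow> nat \<Rightarrow> 'a set" where
  "lead_ideal J d = {a \<in> carrier R. \<exists>s \<in> polys d. h a \<otimes>\<^bsub>S\<^esub> x [^]\<^bsub>S\<^esub> d \<oplus>\<^bsub>S\<^esub> s \<in> J}"

lemma lead_idealI:
  "\<lbrakk>a \<in> carrier R; s \<in> polys d; h a \<otimes>\<^bsub>S\<^esub> x [^]\<^bsub>S\<^esub> d \<oplus>\<^bsub>S\<^esub> s \<in> J\<rbrakk> \<Longrightarrow> a \<in> lead_ideal J d"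
  unfolding lead_ideal_def by auto

lemma ideal_lead_ideal:
  assumes "ideal J S"
  shows "ideal (lead_ideal J d) R"
proof -
  interpret J: ideal J S by fact
  have smult: "r \<otimes> a \<in> lead_ideal J d" if a: "a \<in> lead_ideal J d" and r: "r \<in> carrier R" for a r
  proof -
    obtain s where s: "a \<in> carrier R" "s \<in> polys d" "h a \<otimes>\<^bsub>S\<^esub> x [^]\<^bsub>S\<^esub> d \<oplus>\<^bsub>S\<^esub> s \<in> J"
      using a unfolding lead_ideal_def by auto
    have "h r \<otimes>\<^bsub>S\<^esub> (h a \<otimes>\<^bsub>S\<^esub> x [^]\<^bsub>S\<^esub> d \<oplus>\<^bsub>S\<^esub> s) \<in> J"
      using s r J.I_l_closed by simp
    then have "h (r \<otimes> a) \<otimes>\<^bsub>S\<^esub> x [^]\<^bsub>S\<^esub> d \<oplus>\<^bsub>S\<^esub> h r \<otimes>\<^bsub>S\<^esub> s \<in> J"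
      using s r by (simp add: polys_closed S.r_distr S.m_assoc)
    then show ?thesis by (rule lead_idealI[rotated 2]) (use s r polys_smult in auto)
  qed
  have add: "a \<oplus> b \<in> lead_ideal J d" if a: "a \<in> lead_ideal J d" and b: "b \<in> lead_ideal J d" for a b
  proof -
    obtain s where s: "a \<in> carrier R" "s \<in> polys d" "h a \<otimes>\<^bsub>S\<^esub> x [^]\<^bsub>S\<^esub> d \<oplus>\<^bsub>S\<^esub> s \<in> J"
      using a unfolding lead_ideal_def by auto
    obtain t where t: "b \<in> carrier R" "t \<in> polys d" "h b \<otimes>\<^bsub>S\<^esub> x [^]\<^bsub>S\<^esub> d \<oplus>\<^bsub>S\<^esub> t \<in> J"
      using b unfolding lead_ideal_def by auto
    have "(h a \<otimes>\<^bsub>S\<^esub> x [^]\<^bsub>S\<^esub> d \<oplus>\<^bsub>S\<^esub> s) \<oplus>\<^bsub>S\<^esub> (h b \<otimes>\<^bsub>S\<^esub> x [^]\<^bsub>S\<^esub> d \<oplus>\<^bsub>S\<^esub> t) \<in> J"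
      using s t J.a_closed by simp
    then have "h (a \<oplus> b) \<otimes>\<^bsub>S\<^esub> x [^]\<^bsub>S\<^esub> d \<oplus>\<^bsub>S\<^esub> (s \<oplus>\<^bsub>S\<^esub> t) \<in> J"
      using s t by (simp add: polys_closed S.l_distr S.a_ac)
    then show ?thesis by (rule lead_idealI[rotated 2]) (use s t polys_add in auto)
  qed
  have carr: "lead_ideal J d \<subseteq> carrier R" unfolding lead_ideal_def by auto
  show ?thesis
  proof (rule idealI)
    show "ring R" by (rule R.ring_axioms)
    show "subgroup (lead_ideal J d) (add_monoid R)"
    proof (rule subgroup.intro)
      show "\<one>\<^bsub>add_monoid R\<^esub> \<in> lead_ideal J d"
        using zero_in_polys by (auto intro!: lead_idealI)
      fix a assume a: "a \<in> lead_ideal J d"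
      then have "\<ominus> a = \<ominus> \<one> \<otimes> a" using carr by (simp add: R.l_minus subset_eq)
      then show "inv\<^bsub>add_monoid R\<^esub> a \<in> lead_ideal J d"
        using smult[OF a, of "\<ominus> \<one>"] by (simp add: a_inv_def)
    qed (use carr add in auto)
    show "a \<otimes> r \<in> lead_ideal J d" if "a \<in> lead_ideal J d" "r \<in> carrier R" for a r
      using smult[OF that] that carr by (simp add: R.m_comm subset_eq)
  qed (use smult in auto)
qed

text \<open>Multiplication by \<open>x\<close> keeps an element in \<open>J\<close>, shifts its
  expression up by one degree and leaves the top coefficient alone.\<close>

lemma lead_ideal_mono_Suc:
  assumes "ideal J S"
  shows "lead_ideal J d \<subseteq> lead_ideal J (Suc d)"
proof
  interpret J: ideal J S by fact
  fix a assume "a \<in> lead_ideal J d"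
  then obtain s where s: "a \<in> carrier R" "s \<in> polys d" "h a \<otimes>\<^bsub>S\<^esub> x [^]\<^bsub>S\<^esub> d \<oplus>\<^bsub>S\<^esub> s \<in> J"
    unfolding lead_ideal_def by auto
  have "x \<otimes>\<^bsub>S\<^esub> (h a \<otimes>\<^bsub>S\<^esub> x [^]\<^bsub>S\<^esub> d \<oplus>\<^bsub>S\<^esub> s) \<in> J"
    using s J.I_l_closed by simp
  then have "h a \<otimes>\<^bsub>S\<^esub> x [^]\<^bsub>S\<^esub> Suc d \<oplus>\<^bsub>S\<^esub> x \<otimes>\<^bsub>S\<^esub> s \<in> J"
    using s by (simp add: polys_closed S.r_distr S.m_ac)
  then show "a \<in> lead_ideal J (Suc d)" by (rule lead_idealI[rotated 2]) (use s polys_times_x in auto)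
qed

lemma lead_ideal_mono: "ideal J S \<Longrightarrow> d \<le> e \<Longrightarrow> lead_ideal J d \<subseteq> lead_ideal J e"
  by (rule lift_Suc_mono_le[of "lead_ideal J"]) (auto dest: lead_ideal_mono_Suc)

text \<open>Induction on the degree bound: from \<open>p\<close> in \<open>J\<close> subtract an
  element of \<open>N\<close> with the same top term. The difference lies in \<open>J\<close> and
  has smaller degree bound, so it is in \<open>N\<close> by induction, and then so is
  \<open>p\<close>.\<close>

lemma ideal_subset_by_lead_ideals:
  assumes J: "ideal J S" and N: "ideal N S" and "N \<subseteq> J"
    and lead: "\<And>d. lead_ideal J d \<subseteq> lead_ideal N d"
    and cover: "\<And>s. s \<in> carrier S \<Longrightarrow> \<exists>n. s \<in> polys n"
  shows "J \<subseteq> N"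
proof -
  interpret J: ideal J S by fact
  interpret N: ideal N S by fact
  have "p \<in> J \<Longrightarrow> p \<in> polys n \<Longrightarrow> p \<in> N" for p n
  proof (induction n arbitrary: p)
    case (Suc n)
    obtain a s where p: "a \<in> carrier R" "s \<in> polys n" "p = h a \<otimes>\<^bsub>S\<^esub> x [^]\<^bsub>S\<^esub> n \<oplus>\<^bsub>S\<^esub> s"
      using Suc.prems by (auto elim: polys_SucE)
    then have "a \<in> lead_ideal N n" using Suc.prems lead by (auto intro: lead_idealI)
    then obtain t where t: "t \<in> polys n" "h a \<otimes>\<^bsub>S\<^esub> x [^]\<^bsub>S\<^esub> n \<oplus>\<^bsub>S\<^esub> t \<in> N"
      unfolding lead_ideal_def by auto
    define q where "q = h a \<otimes>\<^bsub>S\<^esub> x [^]\<^bsub>S\<^esub> n \<oplus>\<^bsub>S\<^esub> t"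
    have q: "q \<in> N" "q \<in> J" "q \<in> carrier S" "p \<in> carrier S"
      using t \<open>N \<subseteq> J\<close> Suc.prems by (auto simp: q_def)
    \<comment> \<open>Both expressions carry literally the same summand with coefficient
      \<open>h a\<close>, so it cancels even if expressions in \<open>x\<close> are not
      unique.\<close>
    have "p \<ominus>\<^bsub>S\<^esub> q = s \<ominus>\<^bsub>S\<^esub> t"
      using p t unfolding q_def
      by (simp add: polys_closed S.minus_eq S.minus_add) (simp add: polys_closed S.a_ac S.r_neg2 S.r_neg)
    then have "p \<ominus>\<^bsub>S\<^esub> q \<in> polys n" using p t polys_minus by simp
    moreover have "p \<ominus>\<^bsub>S\<^esub> q \<in> J" using q Suc.prems by (simp add: S.minus_eq)
    ultimately have "p \<ominus>\<^bsub>S\<^esub> q \<in> N" using Suc.IH by blast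
    then have "(p \<ominus>\<^bsub>S\<^esub> q) \<oplus>\<^bsub>S\<^esub> q \<in> N" using q by simp
    then show ?case using q by (simp add: S.minus_eq S.a_assoc S.l_neg)
  qed simp
  then show ?thesis using cover J.Icarr by (meson subsetI)
qed

text \<open>The ideals \<open>lead_ideal J d\<close> increase with \<open>d\<close> and become
  stationary at some \<open>D\<close>. Lifting finitely many generators of each of them for d \<le>
  D to elements of \<open>J\<close> gives a finite set whose ideal has the same leading coefficients
  as \<open>J\<close> in every degree, hence equals \<open>J\<close>.\<close>

theorem hilbert_basis:
  assumes "noetherian_ring R" and cover: "\<And>s. s \<in> carrier S \<Longrightarrow> \<exists>n. s \<in> polys n"
  shows "noetherian_ring S"
proof (rule S.noetherian_ringI)
  interpret R': noetherian_ring R by fact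
  fix J assume J: "ideal J S"
  interpret J: ideal J S by fact
  \<comment> \<open>The ascending chain condition is used in the form that the union of a nonempty
    chain of ideals belongs to the chain; the member that equals the union supplies
    \<open>D\<close>.\<close>
  have "subset.chain {I. ideal I R} (range (lead_ideal J))"
    using ideal_lead_ideal[OF J] lead_ideal_mono[OF J]
    by (auto simp: subset_chain_def) (meson nat_le_linear subsetD)
  then have "\<Union>(range (lead_ideal J)) \<in> range (lead_ideal J)"
    by (intro R'.ideal_chain_is_trivial) auto
  then obtain D where D: "\<And>d. lead_ideal J d \<subseteq> lead_ideal J D" by auto
  have "\<exists>B. B \<subseteq> carrier R \<and> finite B \<and> lead_ideal J d = Idl\<^bsub>R\<^esub> B" for d
    using R'.finetely_gen[OF ideal_lead_ideal[OF J]] by blast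
  then obtain B where B: "\<And>d. B d \<subseteq> carrier R" "\<And>d. finite (B d)" "\<And>d. lead_ideal J d = Idl\<^bsub>R\<^esub> (B d)"
    by metis
  have "\<exists>s \<in> polys d. h b \<otimes>\<^bsub>S\<^esub> x [^]\<^bsub>S\<^esub> d \<oplus>\<^bsub>S\<^esub> s \<in> J" if "b \<in> B d" for b d
  proof -
    \<comment> \<open>The generator \<open>b\<close> is itself a coefficient in
      \<open>lead_ideal J d\<close>; the witness \<open>t b d\<close> chosen from this is the lower
      order tail of a lift of \<open>b\<close> to \<open>J\<close>.\<close>
    have "b \<in> lead_ideal J d" using that B R.genideal_self by blast
    then show ?thesis unfolding lead_ideal_def by auto
  qed
  then obtain t where t: "\<And>b d. b \<in> B d \<Longrightarrow> t b d \<in> polys d"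
      "\<And>b d. b \<in> B d \<Longrightarrow> h b \<otimes>\<^bsub>S\<^esub> x [^]\<^bsub>S\<^esub> d \<oplus>\<^bsub>S\<^esub> t b d \<in> J"
    by metis
  define G where "G = (\<Union>d\<le>D. (\<lambda>b. h b \<otimes>\<^bsub>S\<^esub> x [^]\<^bsub>S\<^esub> d \<oplus>\<^bsub>S\<^esub> t b d) ` B d)"
  have G: "finite G" "G \<subseteq> J" "G \<subseteq> carrier S"
    using B t J.Icarr unfolding G_def by auto
  have N: "ideal (Idl\<^bsub>S\<^esub> G) S" using G S.genideal_ideal by blast
  have NJ: "Idl\<^bsub>S\<^esub> G \<subseteq> J" using G J S.genideal_minimal by blast
  have le: "lead_ideal J d \<subseteq> lead_ideal (Idl\<^bsub>S\<^esub> G) d" if "d \<le> D" for d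
  proof -
    have "b \<in> lead_ideal (Idl\<^bsub>S\<^esub> G) d" if "b \<in> B d" for b
    proof (rule lead_idealI)
      have "h b \<otimes>\<^bsub>S\<^esub> x [^]\<^bsub>S\<^esub> d \<oplus>\<^bsub>S\<^esub> t b d \<in> G"
        using that \<open>d \<le> D\<close> unfolding G_def by auto
      then show "h b \<otimes>\<^bsub>S\<^esub> x [^]\<^bsub>S\<^esub> d \<oplus>\<^bsub>S\<^esub> t b d \<in> Idl\<^bsub>S\<^esub> G"
        using G S.genideal_self by blast
    qed (use that B t in auto)
    then show ?thesis
      unfolding B(3) by (intro R.genideal_minimal ideal_lead_ideal N) auto
  qed
  \<comment> \<open>Beyond \<open>D\<close> no new generators are needed: a coefficient of
    \<open>J\<close> in degree \<open>d\<close> already occurs in degree \<open>D\<close>, there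
    comes from the ideal of \<open>G\<close>, and is carried back up to degree \<open>d\<close> by
    monotonicity.\<close>
  have "lead_ideal J d \<subseteq> lead_ideal (Idl\<^bsub>S\<^esub> G) d" for d
  proof (cases "d \<le> D")
    case False
    then show ?thesis using D[of d] le[of D] lead_ideal_mono[OF N, of D d] by auto
  qed (use le in auto)
  then have "J = Idl\<^bsub>S\<^esub> G"
    using ideal_subset_by_lead_ideals[OF J N NJ _ cover] NJ by blast
  then show "\<exists>A\<subseteq>carrier S. finite A \<and> J = Idl\<^bsub>S\<^esub> A" using G by blast
qed

end

section \<open>The polynomial ring\<close>

context cring
begin

text \<open>The multiplication of \<open>mpoly_ring\<close> under its own name. Since a multiset has
  only finitely many submultisets, each sum is finite, and the product can be studied for arbitrary
  coefficient functions with values in \<open>R\<close>, without finite support.\<close>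

definition conv :: "('c multiset \<Rightarrow> 'a) \<Rightarrow> ('c multiset \<Rightarrow> 'a) \<Rightarrow> ('c multiset \<Rightarrow> 'a)" where
  "conv F G = (\<lambda>\<mu>. \<Oplus>\<nu>\<in>{\<nu>. \<nu> \<subseteq># \<mu>}. F \<nu> \<otimes> G (\<mu> - \<nu>))"

lemma mpoly_ring_simps:
  "carrier (mpoly_ring R m) = indexed_pset {..<m} (carrier R)"
  "monoid.mult (mpoly_ring R m) = conv"
  "monoid.one (mpoly_ring R m) = indexed_const \<one>"
  "ring.zero (mpoly_ring R m) = indexed_const \<zero>"
  "ring.add (mpoly_ring R m) = indexed_padd"
  by (simp_all add: mpoly_ring_def conv_def[abs_def])

lemma finite_submultisets [simp]: "finite {\<nu>. \<nu> \<subseteq># (\<mu> :: 'c multiset)}"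
proof (induction \<mu>)
  case (add x \<mu>)
  have "{\<nu>. \<nu> \<subseteq># add_mset x \<mu>} \<subseteq> {\<nu>. \<nu> \<subseteq># \<mu>} \<union> add_mset x ` {\<nu>. \<nu> \<subseteq># \<mu>}"
  proof
    fix \<nu> assume \<nu>: "\<nu> \<in> {\<nu>. \<nu> \<subseteq># add_mset x \<mu>}"
    show "\<nu> \<in> {\<nu>. \<nu> \<subseteq># \<mu>} \<union> add_mset x ` {\<nu>. \<nu> \<subseteq># \<mu>}"
    proof (cases "x \<in># \<nu>")
      case True
      then obtain \<rho> where "\<nu> = add_mset x \<rho>" by (metis insert_DiffM)
      then show ?thesis using \<nu> by auto
    next
      case False
      then have "\<nu> \<subseteq># \<mu>" using \<nu> by (metis mem_Collect_eq diff_single_trivial subset_eq_diff_conv add_mset_add_single)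
      then show ?thesis by simp
    qed
  qed
  then show ?case using add by (meson finite_UnI finite_imageI finite_subset)
qed simp

section \<open>Algebraic laws of the convolution product\<close>

lemma carrier_coeff_const: "k \<in> carrier R \<Longrightarrow> carrier_coeff (indexed_const k)"
  by (simp add: carrier_coeff_def indexed_const_def)

lemma carrier_coeff_conv:
  "carrier_coeff F \<Longrightarrow> carrier_coeff G \<Longrightarrow> carrier_coeff (conv F G)"
  by (auto simp: carrier_coeff_def conv_def intro!: finsum_closed)

text \<open>Passing to the complement inside \<mu> is an involution on the submultisets of \<mu>,
  and reindexing along it exchanges the two factors.\<close>

lemma conv_comm:
  fixes F :: "'c multiset \<Rightarrow> 'a"
  assumes "carrier_coeff F" "carrier_coeff G"
  shows "conv F G = conv G F"
proof
  fix \<mu> :: "'c multiset"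
  have compl: "\<mu> - (\<mu> - \<nu>) = \<nu>" if "\<nu> \<subseteq># \<mu>" for \<nu>
    using that by (auto simp: multiset_eq_iff subseteq_mset_def)
  have img: "(\<lambda>\<nu>. \<mu> - \<nu>) ` {\<nu>. \<nu> \<subseteq># \<mu>} = {\<nu>. \<nu> \<subseteq># \<mu>}"
  proof (intro equalityI subsetI)
    fix \<nu> assume "\<nu> \<in> {\<nu>. \<nu> \<subseteq># \<mu>}"
    then show "\<nu> \<in> (\<lambda>\<nu>. \<mu> - \<nu>) ` {\<nu>. \<nu> \<subseteq># \<mu>}"
      by (intro image_eqI[of _ _ "\<mu> - \<nu>"]) (auto simp: compl)
  qed auto
  have inj: "inj_on (\<lambda>\<nu>. \<mu> - \<nu>) {\<nu>. \<nu> \<subseteq># \<mu>}"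
    by (rule inj_on_inverseI[of _ "\<lambda>\<nu>. \<mu> - \<nu>"]) (simp add: compl)
  have "conv F G \<mu> = (\<Oplus>\<nu>\<in>(\<lambda>\<nu>. \<mu> - \<nu>) ` {\<nu>. \<nu> \<subseteq># \<mu>}. F \<nu> \<otimes> G (\<mu> - \<nu>))"
    by (simp add: img conv_def)
  also have "\<dots> = (\<Oplus>\<nu>\<in>{\<nu>. \<nu> \<subseteq># \<mu>}. F (\<mu> - \<nu>) \<otimes> G (\<mu> - (\<mu> - \<nu>)))"
    using assms by (intro finsum_reindex inj) (auto simp: carrier_coeff_def)
  also have "\<dots> = conv G F \<mu>"
    unfolding conv_def
    using assms by (intro finsum_cong') (auto simp: carrier_coeff_def compl m_comm)
  finally show "conv F G \<mu> = conv G F \<mu>" .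
qed

text \<open>This and the next two lemmas compute \<open>conv\<close> when its left factor is a sum,
  a constant or a multiple of a variable. These are the constructors of \<open>indexed_pset\<close>,
  so closure and associativity follow by induction on the left factor.\<close>

lemma conv_padd_left:
  fixes F :: "'c multiset \<Rightarrow> 'a"
  assumes "carrier_coeff F" "carrier_coeff G" "carrier_coeff H"
  shows "conv (indexed_padd F G) H = indexed_padd (conv F H) (conv G H)"
proof
  fix \<mu> :: "'c multiset"
  have "conv (indexed_padd F G) H \<mu> =
      (\<Oplus>\<nu>\<in>{\<nu>. \<nu> \<subseteq># \<mu>}. F \<nu> \<otimes> H (\<mu> - \<nu>) \<oplus> G \<nu> \<otimes> H (\<mu> - \<nu>))"
    unfolding conv_def indexed_padd_def
    using assms by (intro finsum_cong') (auto simp: carrier_coeff_def l_distr)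
  also have "\<dots> = indexed_padd (conv F H) (conv G H) \<mu>"
    unfolding conv_def indexed_padd_def
    using assms by (intro finsum_addf) (auto simp: carrier_coeff_def)
  finally show "conv (indexed_padd F G) H \<mu> = indexed_padd (conv F H) (conv G H) \<mu>" .
qed

lemma conv_const_left:
  fixes F :: "'c multiset \<Rightarrow> 'a"
  assumes "k \<in> carrier R" "carrier_coeff F"
  shows "conv (indexed_const k) F = (\<lambda>\<mu>. k \<otimes> F \<mu>)"
proof
  fix \<mu> :: "'c multiset"
  have "conv (indexed_const k) F \<mu> =
      (\<Oplus>\<nu>\<in>{\<nu>. \<nu> \<subseteq># \<mu>}. if {#} = \<nu> then k \<otimes> F (\<mu> - \<nu>) else \<zero>)"
    unfolding conv_def indexed_const_def
    using assms by (intro finsum_cong') (auto simp: carrier_coeff_def)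
  also have "\<dots> = k \<otimes> F (\<mu> - {#})"
    using assms by (intro finsum_singleton) (auto simp: carrier_coeff_def)
  finally show "conv (indexed_const k) F \<mu> = k \<otimes> F \<mu>" by simp
qed

text \<open>Only submultisets that contain \<open>i\<close> contribute, and removing one copy of
  \<open>i\<close> matches them with the submultisets of what remains of \<mu>. If \<open>i\<close>
  does not occur in \<mu>, both sides vanish.\<close>

lemma conv_pmult_left:
  fixes F :: "'c multiset \<Rightarrow> 'a"
  assumes "carrier_coeff F" "carrier_coeff G"
  shows "conv (indexed_pmult F i) G = indexed_pmult (conv F G) i"
proof
  fix \<mu> :: "'c multiset"
  show "conv (indexed_pmult F i) G \<mu> = indexed_pmult (conv F G) i \<mu>"
  proof (cases "i \<in># \<mu>")
    case True
    then obtain \<rho> where \<mu>: "\<mu> = add_mset i \<rho>" by (metis insert_DiffM)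
    have "conv (indexed_pmult F i) G \<mu> =
        (\<Oplus>\<nu>\<in>add_mset i ` {\<nu>. \<nu> \<subseteq># \<rho>}. indexed_pmult F i \<nu> \<otimes> G (\<mu> - \<nu>))"
      unfolding conv_def
    proof (rule add.finprod_mono_neutral_cong_right)
      fix \<nu> assume \<nu>: "\<nu> \<in> {\<nu>. \<nu> \<subseteq># \<mu>} - add_mset i ` {\<nu>. \<nu> \<subseteq># \<rho>}"
      have "i \<notin># \<nu>"
      proof
        assume "i \<in># \<nu>"
        then obtain \<sigma> where "\<nu> = add_mset i \<sigma>" by (metis insert_DiffM)
        then show False using \<nu> \<mu> by auto
      qed
      then show "indexed_pmult F i \<nu> \<otimes> G (\<mu> - \<nu>) = \<zero>"
        using assms by (simp add: indexed_pmult_def carrier_coeff_def)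
    qed (use assms \<mu> in \<open>auto simp: carrier_coeff_def indexed_pmult_def\<close>)
    also have "\<dots> = (\<Oplus>\<nu>\<in>{\<nu>. \<nu> \<subseteq># \<rho>}. indexed_pmult F i (add_mset i \<nu>) \<otimes> G (\<mu> - add_mset i \<nu>))"
      using assms by (intro finsum_reindex) (auto simp: carrier_coeff_def indexed_pmult_def inj_on_def)
    also have "\<dots> = indexed_pmult (conv F G) i \<mu>"
      using \<mu> by (simp add: conv_def indexed_pmult_def)
    finally show ?thesis .
  next
    case False
    have "conv (indexed_pmult F i) G \<mu> = \<zero>"
      unfolding conv_def
    proof (rule add.finprod_one_eqI)
      fix \<nu> assume "\<nu> \<in> {\<nu>. \<nu> \<subseteq># \<mu>}"
      then have "i \<notin># \<nu>" using False by (auto dest: mset_subset_eqD)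
      then show "indexed_pmult F i \<nu> \<otimes> G (\<mu> - \<nu>) = \<zero>"
        using assms by (simp add: indexed_pmult_def carrier_coeff_def)
    qed
    then show ?thesis using False by (simp add: indexed_pmult_def)
  qed
qed

lemma indexed_pset_coeff: "F \<in> indexed_pset I (carrier R) \<Longrightarrow> carrier_coeff F"
  using indexed_pset_in_carrier by blast

lemma indexed_pset_smult:
  assumes "F \<in> indexed_pset I (carrier R)" "k \<in> carrier R"
  shows "(\<lambda>\<mu>. k \<otimes> F \<mu>) \<in> indexed_pset I (carrier R)"
  using assms(1)
proof induction
  case (indexed_const a)
  have eq: "(\<lambda>\<mu>. k \<otimes> indexed_const a \<mu>) = indexed_const (k \<otimes> a)"
    using assms(2) by (auto simp: indexed_const_def)
  show ?case unfolding eq using indexed_const assms(2) by (intro indexed_pset.indexed_const) simp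
next
  case (indexed_padd P Q)
  have eq: "(\<lambda>\<mu>. k \<otimes> indexed_padd P Q \<mu>) = indexed_padd (\<lambda>\<mu>. k \<otimes> P \<mu>) (\<lambda>\<mu>. k \<otimes> Q \<mu>)"
    using assms(2) indexed_padd.hyps[THEN indexed_pset_coeff]
    by (auto simp: indexed_padd_def carrier_coeff_def r_distr)
  show ?case unfolding eq using indexed_padd.IH by (rule indexed_pset.indexed_padd)
next
  case (indexed_pmult P i)
  have eq: "(\<lambda>\<mu>. k \<otimes> indexed_pmult P i \<mu>) = indexed_pmult (\<lambda>\<mu>. k \<otimes> P \<mu>) i"
    using assms(2) by (auto simp: indexed_pmult_def)
  show ?case unfolding eq using indexed_pmult.IH indexed_pmult.hyps(2) by (rule indexed_pset.indexed_pmult)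
qed

lemma indexed_pset_conv:
  assumes "F \<in> indexed_pset I (carrier R)" "G \<in> indexed_pset I (carrier R)"
  shows "conv F G \<in> indexed_pset I (carrier R)"
  using assms(1)
proof induction
  case (indexed_const a)
  then show ?case
    using indexed_pset_smult[OF assms(2)] indexed_pset_coeff[OF assms(2)]
    by (simp only: conv_const_left)
next
  case (indexed_padd P Q)
  then show ?case
    using assms(2)[THEN indexed_pset_coeff] indexed_padd.hyps[THEN indexed_pset_coeff]
    by (simp add: conv_padd_left indexed_pset.indexed_padd)
next
  case (indexed_pmult P i)
  then show ?case
    using assms(2)[THEN indexed_pset_coeff] indexed_pmult.hyps(1)[THEN indexed_pset_coeff]
    by (simp add: conv_pmult_left indexed_pset.indexed_pmult)
qed

text \<open>Induction on \<open>F\<close> replaces the reindexing of a double sum over submultisets.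
  Only the first factor has to be a polynomial for this.\<close>

lemma conv_assoc:
  assumes "F \<in> indexed_pset I (carrier R)" "carrier_coeff G" "carrier_coeff H"
  shows "conv (conv F G) H = conv F (conv G H)"
  using assms(1)
proof induction
  case (indexed_const a)
  have "conv (\<lambda>\<mu>. a \<otimes> G \<mu>) H \<mu> = a \<otimes> conv G H \<mu>" for \<mu>
  proof -
    have "conv (\<lambda>\<mu>. a \<otimes> G \<mu>) H \<mu> = (\<Oplus>\<nu>\<in>{\<nu>. \<nu> \<subseteq># \<mu>}. a \<otimes> (G \<nu> \<otimes> H (\<mu> - \<nu>)))"
      unfolding conv_def using assms indexed_const
      by (intro finsum_cong') (auto simp: carrier_coeff_def m_assoc)
    also have "\<dots> = a \<otimes> conv G H \<mu>"
      unfolding conv_def using assms indexed_const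
      by (intro finsum_rdistr[symmetric]) (auto simp: carrier_coeff_def)
    finally show ?thesis .
  qed
  then have "conv (\<lambda>\<mu>. a \<otimes> G \<mu>) H = (\<lambda>\<mu>. a \<otimes> conv G H \<mu>)" by blast
  then show ?case
    using indexed_const assms by (simp add: conv_const_left carrier_coeff_conv)
next
  case (indexed_padd P Q)
  then show ?case
    using assms indexed_padd.hyps[THEN indexed_pset_coeff]
    by (simp add: conv_padd_left carrier_coeff_conv)
next
  case (indexed_pmult P i)
  then show ?case
    using assms indexed_pmult.hyps(1)[THEN indexed_pset_coeff]
    by (simp add: conv_pmult_left carrier_coeff_conv)
qed

section \<open>The ring structure, and the passage to one more variable\<close>

lemma mpoly_ring_cring: "cring (mpoly_ring R m)"
proof (rule cringI)
  note coeffs = indexed_pset_coeff carrier_coeff_const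
  show "abelian_group (mpoly_ring R m)"
  proof (rule abelian_groupI, unfold mpoly_ring_simps)
    fix F assume F: "F \<in> indexed_pset {..<m} (carrier R)"
    \<comment> \<open>The additive inverse is the multiple of \<open>F\<close> by minus one, which
      lies in the carrier by \<open>indexed_pset_smult\<close>.\<close>
    have "indexed_padd (\<lambda>\<mu>. (\<ominus> \<one>) \<otimes> F \<mu>) F = indexed_const \<zero>"
      using indexed_pset_coeff[OF F]
      by (auto simp: indexed_padd_def indexed_const_def carrier_coeff_def l_minus l_neg)
    then show "\<exists>G\<in>indexed_pset {..<m} (carrier R). indexed_padd G F = indexed_const \<zero>"
      using indexed_pset_smult[OF F] by blast
  qed (auto intro: indexed_pset.intros,
      auto dest!: coeffs simp: indexed_padd_def indexed_const_def carrier_coeff_def a_ac)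
  show "Group.comm_monoid (mpoly_ring R m)"
  proof (rule comm_monoidI, unfold mpoly_ring_simps)
    fix F assume F: "F \<in> indexed_pset {..<m} (carrier R)"
    then show "conv (indexed_const \<one>) F = F"
      using indexed_pset_coeff[OF F] by (simp add: conv_const_left carrier_coeffE)
  qed (auto intro: indexed_pset.indexed_const indexed_pset_conv conv_assoc conv_comm coeffs)
  fix F G H assume "F \<in> carrier (mpoly_ring R m)" "G \<in> carrier (mpoly_ring R m)"
    "H \<in> carrier (mpoly_ring R m)"
  then show "(F \<oplus>\<^bsub>mpoly_ring R m\<^esub> G) \<otimes>\<^bsub>mpoly_ring R m\<^esub> H =
      F \<otimes>\<^bsub>mpoly_ring R m\<^esub> H \<oplus>\<^bsub>mpoly_ring R m\<^esub> G \<otimes>\<^bsub>mpoly_ring R m\<^esub> H"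
    by (simp add: mpoly_ring_simps coeffs conv_padd_left)
qed

lemma indexed_const_in_mpoly_ring [simp]:
  "k \<in> carrier R \<Longrightarrow> indexed_const k \<in> carrier (mpoly_ring R m)"
  by (simp add: mpoly_ring_simps indexed_pset.indexed_const)

lemma indexed_pmult_in_mpoly_ring:
  "\<lbrakk>F \<in> carrier (mpoly_ring R m); i < m\<rbrakk> \<Longrightarrow> indexed_pmult F i \<in> carrier (mpoly_ring R m)"
  by (simp add: mpoly_ring_simps indexed_pset.indexed_pmult)

lemma indexed_var_in_mpoly_ring [simp]:
  "i < m \<Longrightarrow> indexed_var i \<in> carrier (mpoly_ring R m)"
  by (simp add: indexed_var_def indexed_pmult_in_mpoly_ring)

lemma indexed_const_hom: "ring_hom_cring R (mpoly_ring R m) indexed_const"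
proof (intro ring_hom_cring.intro ring_hom_cring_axioms.intro ring_hom_memI)
  fix a b assume "a \<in> carrier R" "b \<in> carrier R"
  then show "indexed_const (a \<otimes> b) = indexed_const a \<otimes>\<^bsub>mpoly_ring R m\<^esub> indexed_const b"
    by (auto simp: mpoly_ring_simps conv_const_left carrier_coeff_const) (auto simp: indexed_const_def)
qed (simp_all add: mpoly_ring_cring is_cring, simp_all add: mpoly_ring_simps indexed_padd_const)

lemma mpoly_ring_coeff: "F \<in> carrier (mpoly_ring R m) \<Longrightarrow> F \<mu> \<in> carrier R"
  using indexed_pset_coeff carrier_coeffE unfolding mpoly_ring_simps by blast

lemma const_mult_apply:
  "\<lbrakk>k \<in> carrier R; F \<in> carrier (mpoly_ring R m)\<rbrakk> \<Longrightarrow>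
    (indexed_const k \<otimes>\<^bsub>mpoly_ring R m\<^esub> F) \<mu> = k \<otimes> F \<mu>"
  using indexed_pset_coeff[of F "{..<m}"] by (simp add: mpoly_ring_simps conv_const_left)

text \<open>This translates the constructor \<open>indexed_pmult\<close> into a product of ring
  elements, the form to which ring homomorphisms and ideals apply.\<close>

lemma var_mult:
  assumes "F \<in> carrier (mpoly_ring R m)"
  shows "indexed_var i \<otimes>\<^bsub>mpoly_ring R m\<^esub> F = indexed_pmult F i"
proof -
  have F: "carrier_coeff F" using assms indexed_pset_coeff by (simp add: mpoly_ring_simps)
  then have "conv (indexed_const \<one>) F = F" by (simp add: conv_const_left carrier_coeffE)
  then show ?thesis
    using F by (simp add: mpoly_ring_simps indexed_var_def conv_pmult_left carrier_coeff_const)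
qed

lemma mpoly_ring_mono: "F \<in> carrier (mpoly_ring R m) \<Longrightarrow> F \<in> carrier (mpoly_ring R (Suc m))"
  unfolding mpoly_ring_simps by (induction rule: indexed_pset.induct) (auto intro: indexed_pset.intros)

text \<open>Only the carrier of \<open>mpoly_ring R m\<close> depends on \<open>m\<close>; the
  operations and constants are the same functions. The inclusion is therefore the identity
  map.\<close>

lemma mpoly_ring_Suc_hom: "ring_hom_cring (mpoly_ring R m) (mpoly_ring R (Suc m)) (\<lambda>F. F)"
  by (intro ring_hom_cring.intro ring_hom_cring_axioms.intro ring_hom_memI)
    (simp_all add: mpoly_ring_cring mpoly_ring_mono, simp_all add: mpoly_ring_simps)

text \<open>Induction on the number of variables, each step adjoining the last variable by
  \<open>hilbert_basis\<close>. The covering hypothesis is checked along the constructors of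
  \<open>indexed_pset\<close>.\<close>

lemma noetherian_mpoly_ring:
  assumes "noetherian_ring R"
  shows "noetherian_ring (mpoly_ring R m)"
proof (induction m)
  case 0
  interpret C: ring_hom_cring R "mpoly_ring R 0" indexed_const by (rule indexed_const_hom)
  \<comment> \<open>\<open>indexed_const\<close> is onto here, so adjoining \<open>\<zero>\<close> already gives everything.\<close>
  interpret A: ring_adjoin R "mpoly_ring R 0" indexed_const "\<zero>\<^bsub>mpoly_ring R 0\<^esub>"
    by unfold_locales simp
  show ?case
  proof (rule A.hilbert_basis[OF assms])
    fix F assume "F \<in> carrier (mpoly_ring R 0)"
    then have "F \<in> indexed_pset {..<0} (carrier R)" by (simp add: mpoly_ring_simps)
    then show "\<exists>n. F \<in> A.polys n"
    proof induction
      case (indexed_const k)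
      then show ?case using A.hom_in_polys by blast
    next
      case (indexed_padd P Q)
      then show ?case using A.polys_add_max by (metis mpoly_ring_simps(5))
    qed simp
  qed
next
  case (Suc m)
  interpret C: ring_hom_cring "mpoly_ring R m" "mpoly_ring R (Suc m)" "\<lambda>F. F"
    by (rule mpoly_ring_Suc_hom)
  interpret A: ring_adjoin "mpoly_ring R m" "mpoly_ring R (Suc m)" "\<lambda>F. F" "indexed_var m"
    by unfold_locales simp
  show ?case
  proof (rule A.hilbert_basis[OF Suc])
    fix F assume "F \<in> carrier (mpoly_ring R (Suc m))"
    then have "F \<in> indexed_pset {..<Suc m} (carrier R)" by (simp add: mpoly_ring_simps)
    then show "\<exists>n. F \<in> A.polys n"
    proof induction
      case (indexed_const k)
      then show ?case using A.hom_in_polys indexed_const_in_mpoly_ring by blast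
    next
      case (indexed_padd P Q)
      then show ?case using A.polys_add_max by (metis mpoly_ring_simps(5))
    next
      case (indexed_pmult P i)
      then obtain n where n: "P \<in> A.polys n" by blast
      have eq: "indexed_pmult P i = indexed_var i \<otimes>\<^bsub>mpoly_ring R (Suc m)\<^esub> P"
        using var_mult[OF A.polys_closed[OF n]] by simp
      show ?case
      \<comment> \<open>Multiplication by the adjoined variable raises the degree bound by one,
        whereas a variable with smaller index is a scalar from \<open>mpoly_ring R m\<close> and
        keeps the bound.\<close>
      proof (cases "i = m")
        case True
        then show ?thesis using A.polys_times_x[OF n] eq by auto
      next
        case False
        then show ?thesis
          using A.polys_smult[OF indexed_var_in_mpoly_ring n, of i] eq indexed_pmult by auto
      qed
    qed
  qed
qed

end

section \<open>Colon ideals and ring homomorphisms\<close>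

text \<open>The colon ideals of \<open>L\<close> by the powers of \<open>a\<close> form an ascending
  chain, which is stationary. The order of quantifiers is the point: one exponent \<open>N\<close>
  serves all \<open>z\<close>, however large the exponent \<open>k\<close> that works for
  \<open>z\<close>.\<close>

lemma (in noetherian_ring) colon_powers_stabilize:
  assumes "cring R" "ideal L R" "a \<in> carrier R"
  shows "\<exists>N::nat. \<forall>z \<in> carrier R. \<forall>k::nat. a [^] k \<otimes> z \<in> L \<longrightarrow> a [^] N \<otimes> z \<in> L"
proof -
  interpret cring R by fact
  interpret L: ideal L R by fact
  define Q where "Q k = {z \<in> carrier R. a [^] k \<otimes> z \<in> L}" for k :: nat
  have ideal: "ideal (Q k) R" for k
  proof (rule idealI)
    show "subgroup (Q k) (add_monoid R)"
    proof (rule subgroup.intro)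
      fix z assume "z \<in> Q k"
      then show "inv\<^bsub>add_monoid R\<^esub> z \<in> Q k"
        using assms(3) unfolding Q_def by (simp add: a_inv_def[symmetric] r_minus L.a_inv_closed)
    qed (use assms(3) L.zero_closed in \<open>auto simp: Q_def r_distr\<close>)
    show *: "r \<otimes> z \<in> Q k" if "z \<in> Q k" "r \<in> carrier R" for z r
      using that assms(3) L.I_l_closed[of "a [^] k \<otimes> z" r] by (simp add: Q_def m_lcomm)
    show "z \<otimes> r \<in> Q k" if "z \<in> Q k" "r \<in> carrier R" for z r
      using *[OF that] that by (simp add: Q_def m_comm)
  qed (rule ring_axioms)
  have mono_Suc: "Q k \<subseteq> Q (Suc k)" for k
  proof
    fix z assume "z \<in> Q k"
    then have "z \<in> carrier R" "a [^] k \<otimes> z \<in> L" by (auto simp: Q_def)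
    then show "z \<in> Q (Suc k)"
      using assms(3) L.I_l_closed[of "a [^] k \<otimes> z" a] by (simp add: Q_def m_ac)
  qed
  have mono: "Q k \<subseteq> Q l" if "k \<le> l" for k l
    using that by (rule lift_Suc_mono_le[of Q, rotated]) (rule mono_Suc)
  have "subset.chain {I. ideal I R} (range Q)"
    using ideal mono by (auto simp: subset_chain_def) (meson nat_le_linear subsetD)
  then have "\<Union>(range Q) \<in> range Q"
    by (intro ideal_chain_is_trivial) auto
  then obtain N where "\<And>k. Q k \<subseteq> Q N" by auto
  then show ?thesis unfolding Q_def by blast
qed

text \<open>The recursion for the value of a monomial when one variable is added. It is stated for
  any commutative monoid since it is applied both in \<open>R\<close> and in
  \<open>UP R\<close>.\<close>

lemma (in comm_monoid) finprod_add_mset: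
  assumes "z \<in> set_mset (add_mset i \<mu>) \<rightarrow> carrier G"
  shows "(\<Otimes>j\<in>set_mset (add_mset i \<mu>). z j [^] count (add_mset i \<mu>) j) =
    z i \<otimes> (\<Otimes>j\<in>set_mset \<mu>. z j [^] count \<mu> j)"
proof -
  let ?B = "set_mset (add_mset i \<mu>)"
  have "(\<Otimes>j\<in>?B. z j [^] count (add_mset i \<mu>) j) =
      (\<Otimes>j\<in>?B. (if i = j then z j else \<one>) \<otimes> z j [^] count \<mu> j)"
    using assms by (intro finprod_cong') (auto simp: Pi_iff m_comm)
  also have "\<dots> = (\<Otimes>j\<in>?B. if i = j then z j else \<one>) \<otimes> (\<Otimes>j\<in>?B. z j [^] count \<mu> j)"
    using assms by (intro finprod_multf) auto
  also have "(\<Otimes>j\<in>?B. if i = j then z j else \<one>) = z i"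
    using assms by (intro finprod_singleton) auto
  also have "(\<Otimes>j\<in>?B. z j [^] count \<mu> j) = (\<Otimes>j\<in>set_mset \<mu>. z j [^] count \<mu> j)"
    using assms by (intro finprod_mono_neutral_cong_right) (auto simp: not_in_iff)
  finally show ?thesis .
qed

text \<open>Adding two indicators, instead of distinguishing cases, also covers
  \<open>j = k\<close>. The lemma is used with the constant embedding to form a linear relation, and
  with the identity of \<open>R\<close> to check that its coefficients annihilate the
  generators.\<close>

lemma (in ring_hom_cring) finsum_two_terms:
  assumes "finite J" "j \<in> J" "k \<in> J" "u \<in> carrier R" "v \<in> carrier R" "Y \<in> J \<rightarrow> carrier S"
  shows "(\<Oplus>\<^bsub>S\<^esub>i\<in>J. h ((if j = i then u else \<zero>) \<oplus> (if k = i then v else \<zero>)) \<otimes>\<^bsub>S\<^esub> Y i) =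
    h u \<otimes>\<^bsub>S\<^esub> Y j \<oplus>\<^bsub>S\<^esub> h v \<otimes>\<^bsub>S\<^esub> Y k"
proof -
  have "(\<Oplus>\<^bsub>S\<^esub>i\<in>J. h ((if j = i then u else \<zero>) \<oplus> (if k = i then v else \<zero>)) \<otimes>\<^bsub>S\<^esub> Y i) =
      (\<Oplus>\<^bsub>S\<^esub>i\<in>J. (if j = i then h u \<otimes>\<^bsub>S\<^esub> Y i else \<zero>\<^bsub>S\<^esub>) \<oplus>\<^bsub>S\<^esub> (if k = i then h v \<otimes>\<^bsub>S\<^esub> Y i else \<zero>\<^bsub>S\<^esub>))"
    using assms by (intro S.finsum_cong') (auto simp: S.l_distr Pi_def)
  also have "\<dots> = (\<Oplus>\<^bsub>S\<^esub>i\<in>J. if j = i then h u \<otimes>\<^bsub>S\<^esub> Y i else \<zero>\<^bsub>S\<^esub>) \<oplus>\<^bsub>S\<^esub>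
      (\<Oplus>\<^bsub>S\<^esub>i\<in>J. if k = i then h v \<otimes>\<^bsub>S\<^esub> Y i else \<zero>\<^bsub>S\<^esub>)"
    using assms by (intro S.finsum_addf) (auto simp: Pi_iff)
  also have "(\<Oplus>\<^bsub>S\<^esub>i\<in>J. if j = i then h u \<otimes>\<^bsub>S\<^esub> Y i else \<zero>\<^bsub>S\<^esub>) = h u \<otimes>\<^bsub>S\<^esub> Y j"
    using assms by (intro S.finsum_singleton) auto
  also have "(\<Oplus>\<^bsub>S\<^esub>i\<in>J. if k = i then h v \<otimes>\<^bsub>S\<^esub> Y i else \<zero>\<^bsub>S\<^esub>) = h v \<otimes>\<^bsub>S\<^esub> Y k"
    using assms by (intro S.finsum_singleton) auto
  finally show ?thesis .
qed

text \<open>The witness \<open>H\<close> can be chosen additively and compatibly with multiples of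
  \<open>g\<close>, hence the ideal property. To get such an \<open>H\<close> for every
  \<open>g\<close> in the ideal of the generators it then suffices to treat the generators, without
  writing \<open>g\<close> as a linear combination.\<close>

lemma (in ring_hom_cring) ideal_proportional:
  assumes "f \<in> J \<rightarrow> carrier R" "Y \<in> J \<rightarrow> carrier S"
  shows "ideal {g \<in> carrier R. \<exists>H \<in> carrier S. \<forall>j \<in> J. h g \<otimes>\<^bsub>S\<^esub> Y j = h (f j) \<otimes>\<^bsub>S\<^esub> H} R"
    (is "ideal ?P R")
proof (rule idealI)
  have carr: "j \<in> J \<Longrightarrow> Y j \<in> carrier S" "j \<in> J \<Longrightarrow> h (f j) \<in> carrier S" for j
    using assms by auto
  show mult: "r \<otimes> g \<in> ?P" if g: "g \<in> ?P" and r: "r \<in> carrier R" for g r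
  proof -
    obtain H where H: "g \<in> carrier R" "H \<in> carrier S" "\<forall>j \<in> J. h g \<otimes>\<^bsub>S\<^esub> Y j = h (f j) \<otimes>\<^bsub>S\<^esub> H"
      using g by auto
    then have "h (r \<otimes> g) \<otimes>\<^bsub>S\<^esub> Y j = h (f j) \<otimes>\<^bsub>S\<^esub> (h r \<otimes>\<^bsub>S\<^esub> H)" if "j \<in> J" for j
      using that r carr[OF that] by (simp add: S.m_assoc S.m_lcomm)
    then show ?thesis using H r by blast
  qed
  show "g \<otimes> r \<in> ?P" if "g \<in> ?P" "r \<in> carrier R" for g r
  proof -
    have "g \<in> carrier R" using that by simp
    then show ?thesis using mult[OF that] that(2) by (simp only: R.m_comm)
  qed
  show "subgroup ?P (add_monoid R)"
  proof (rule subgroup.intro)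
    show "\<one>\<^bsub>add_monoid R\<^esub> \<in> ?P" using carr by (auto intro!: bexI[of _ "\<zero>\<^bsub>S\<^esub>"])
    fix a assume a: "a \<in> ?P"
    then have "\<ominus> \<one> \<otimes> a = \<ominus> a" by (simp add: R.l_minus)
    then show "inv\<^bsub>add_monoid R\<^esub> a \<in> ?P"
      using mult[OF a, of "\<ominus> \<one>"] by (simp add: a_inv_def)
    fix b assume b: "b \<in> ?P"
    obtain H where H: "a \<in> carrier R" "H \<in> carrier S" "\<forall>j \<in> J. h a \<otimes>\<^bsub>S\<^esub> Y j = h (f j) \<otimes>\<^bsub>S\<^esub> H"
      using a by auto
    obtain K where K: "b \<in> carrier R" "K \<in> carrier S" "\<forall>j \<in> J. h b \<otimes>\<^bsub>S\<^esub> Y j = h (f j) \<otimes>\<^bsub>S\<^esub> K"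
      using b by auto
    have "h (a \<oplus> b) \<otimes>\<^bsub>S\<^esub> Y j = h (f j) \<otimes>\<^bsub>S\<^esub> (H \<oplus>\<^bsub>S\<^esub> K)" if "j \<in> J" for j
      using H K that carr[OF that] by (simp add: S.l_distr S.r_distr)
    then show "a \<otimes>\<^bsub>add_monoid R\<^esub> b \<in> ?P" using H K by auto
  qed auto
qed (rule R.ring_axioms)

section \<open>Powers annihilating the kernel modulo the linear relations\<close>

context cring
begin

section \<open>Monomials and the expansion of a polynomial in them\<close>

definition indexed_monom :: "'c multiset \<Rightarrow> ('c multiset \<Rightarrow> 'a)" where
  "indexed_monom \<mu> = (\<lambda>\<nu>. if \<nu> = \<mu> then \<one> else \<zero>)"

lemma indexed_monom_empty: "indexed_monom {#} = indexed_const \<one>"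
  by (simp add: indexed_monom_def indexed_const_def)

lemma indexed_monom_add_mset: "indexed_monom (add_mset i \<mu>) = indexed_pmult (indexed_monom \<mu>) i"
  by (auto simp: indexed_monom_def indexed_pmult_def fun_eq_iff dest: multi_member_split)

lemma indexed_monom_in_mpoly_ring:
  "set_mset \<mu> \<subseteq> {..<m} \<Longrightarrow> indexed_monom \<mu> \<in> carrier (mpoly_ring R m)"
  by (induction \<mu>) (auto simp: indexed_monom_empty indexed_monom_add_mset indexed_pmult_in_mpoly_ring)

text \<open>The carrier is given inductively, so finiteness of the support has to be recovered from
  the constructors. It makes the sum in \<open>rees_hom\<close> finite and bounds the
  degrees.\<close>

lemma mpoly_ring_support:
  assumes "F \<in> carrier (mpoly_ring R m)"
  shows "finite {\<mu>. F \<mu> \<noteq> \<zero>} \<and> (\<forall>\<mu>. F \<mu> \<noteq> \<zero> \<longrightarrow> set_mset \<mu> \<subseteq> {..<m})"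
  using assms unfolding mpoly_ring_simps
proof induction
  case (indexed_const k)
  have "{\<mu>. indexed_const k \<mu> \<noteq> \<zero>} \<subseteq> {{#}}" by (auto simp: indexed_const_def)
  then show ?case by (auto simp: indexed_const_def intro: finite_subset)
next
  case (indexed_padd P Q)
  have "{\<mu>. indexed_padd P Q \<mu> \<noteq> \<zero>} \<subseteq> {\<mu>. P \<mu> \<noteq> \<zero>} \<union> {\<mu>. Q \<mu> \<noteq> \<zero>}"
    by (auto simp: indexed_padd_def)
  moreover have "finite ({\<mu>. P \<mu> \<noteq> \<zero>} \<union> {\<mu>. Q \<mu> \<noteq> \<zero>})" using indexed_padd by simp
  ultimately have "finite {\<mu>. indexed_padd P Q \<mu> \<noteq> \<zero>}" by (rule finite_subset)
  then show ?case using indexed_padd by (auto simp: indexed_padd_def) (metis l_zero lessThan_iff subsetD zero_closed)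
next
  case (indexed_pmult P i)
  have "{\<mu>. indexed_pmult P i \<mu> \<noteq> \<zero>} \<subseteq> add_mset i ` {\<mu>. P \<mu> \<noteq> \<zero>}"
    by (auto simp: indexed_pmult_def image_iff dest: multi_member_split split: if_splits)
  moreover have "finite (add_mset i ` {\<mu>. P \<mu> \<noteq> \<zero>})" using indexed_pmult by simp
  ultimately have fin: "finite {\<mu>. indexed_pmult P i \<mu> \<noteq> \<zero>}" by (rule finite_subset)
  have "set_mset \<mu> \<subseteq> {..<m}" if "indexed_pmult P i \<mu> \<noteq> \<zero>" for \<mu>
  proof -
    have "i \<in># \<mu>" "P (\<mu> - {#i#}) \<noteq> \<zero>"
      using that by (auto simp: indexed_pmult_def split: if_splits)
    moreover from this obtain \<nu> where "\<mu> = add_mset i \<nu>" by (metis insert_DiffM)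
    ultimately show ?thesis using indexed_pmult by auto
  qed
  then show ?case using fin by blast
qed

lemma mpoly_ring_finsum_apply:
  assumes "finite A" "P \<in> A \<rightarrow> carrier (mpoly_ring R m)"
  shows "(\<Oplus>\<^bsub>mpoly_ring R m\<^esub>a\<in>A. P a) \<mu> = (\<Oplus>a\<in>A. P a \<mu>)"
proof -
  interpret T: cring "mpoly_ring R m" by (rule mpoly_ring_cring)
  show ?thesis
    using assms
  proof (induction A)
    case empty
    then show ?case by (simp add: T.finsum_empty) (simp add: mpoly_ring_simps indexed_const_def)
  next
    case (insert a A)
    have "(\<Oplus>\<^bsub>mpoly_ring R m\<^esub>a\<in>insert a A. P a) \<mu> =
        (P a \<oplus>\<^bsub>mpoly_ring R m\<^esub> (\<Oplus>\<^bsub>mpoly_ring R m\<^esub>a\<in>A. P a)) \<mu>"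
      using insert by (subst T.finsum_insert) auto
    also have "\<dots> = P a \<mu> \<oplus> (\<Oplus>\<^bsub>mpoly_ring R m\<^esub>a\<in>A. P a) \<mu>"
      by (simp add: mpoly_ring_simps(5) indexed_padd_def)
    also have "\<dots> = (\<Oplus>a\<in>insert a A. P a \<mu>)"
      using insert mpoly_ring_coeff by (subst finsum_insert) (auto simp: Pi_iff)
    finally show ?case .
  qed
qed

lemma mpoly_ring_decomp:
  assumes F: "F \<in> carrier (mpoly_ring R m)"
  shows "F = (\<Oplus>\<^bsub>mpoly_ring R m\<^esub>\<mu>\<in>{\<mu>. F \<mu> \<noteq> \<zero>}.
    indexed_const (F \<mu>) \<otimes>\<^bsub>mpoly_ring R m\<^esub> indexed_monom \<mu>)" (is "F = finsum _ ?X ?A")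
proof
  interpret T: cring "mpoly_ring R m" by (rule mpoly_ring_cring)
  fix \<nu>
  note supp = mpoly_ring_support[OF F]
  have monom: "indexed_monom \<mu> \<in> carrier (mpoly_ring R m)" if "\<mu> \<in> ?A" for \<mu>
    using that supp by (intro indexed_monom_in_mpoly_ring) auto
  have X: "?X \<in> ?A \<rightarrow> carrier (mpoly_ring R m)"
    using monom mpoly_ring_coeff[OF F] by auto
  have "finsum (mpoly_ring R m) ?X ?A \<nu> = (\<Oplus>\<mu>\<in>?A. ?X \<mu> \<nu>)"
    using supp X by (intro mpoly_ring_finsum_apply) auto
  also have "\<dots> = (\<Oplus>\<mu>\<in>?A. if \<nu> = \<mu> then F \<mu> else \<zero>)"
    using monom mpoly_ring_coeff[OF F]
    by (intro finsum_cong') (auto simp: const_mult_apply indexed_monom_def)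
  also have "\<dots> = F \<nu>"
  proof (cases "F \<nu> = \<zero>")
    case True
    then show ?thesis by (intro trans[OF add.finprod_one_eqI]) auto
  next
    case False
    then show ?thesis using supp mpoly_ring_coeff[OF F] by (intro finsum_singleton) auto
  qed
  finally show "F \<nu> = finsum (mpoly_ring R m) ?X ?A \<nu>" by simp
qed

text \<open>Each variable contributes one factor \<open>t\<close>, so the value of a monomial is the
  product of the corresponding \<open>f j\<close> times the power of \<open>t\<close> given by its
  degree, which is the size of the multiset.\<close>

lemma monomial_value_UP:
  assumes "f \<in> set_mset \<mu> \<rightarrow> carrier R"
  shows "(\<Otimes>\<^bsub>UP R\<^esub>j\<in>set_mset \<mu>. up_ring.monom (UP R) (f j) 1 [^]\<^bsub>UP R\<^esub> count \<mu> j) =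
    up_ring.monom (UP R) (\<Otimes>j\<in>set_mset \<mu>. f j [^] count \<mu> j) (size \<mu>)"
proof -
  interpret U: UP_cring R "UP R" by unfold_locales simp
  show ?thesis
    using assms
  proof (induction \<mu>)
    case empty
    then show ?case by (simp add: U.monom_one)
  next
    case (add i \<mu>)
    have "(\<Otimes>\<^bsub>UP R\<^esub>j\<in>set_mset (add_mset i \<mu>). up_ring.monom (UP R) (f j) 1 [^]\<^bsub>UP R\<^esub> count (add_mset i \<mu>) j) =
        up_ring.monom (UP R) (f i) 1 \<otimes>\<^bsub>UP R\<^esub>
          (\<Otimes>\<^bsub>UP R\<^esub>j\<in>set_mset \<mu>. up_ring.monom (UP R) (f j) 1 [^]\<^bsub>UP R\<^esub> count \<mu> j)"
      using add.prems by (intro U.P.finprod_add_mset) (auto simp: Pi_iff)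
    also have "\<dots> = up_ring.monom (UP R) (f i) 1 \<otimes>\<^bsub>UP R\<^esub>
        up_ring.monom (UP R) (\<Otimes>j\<in>set_mset \<mu>. f j [^] count \<mu> j) (size \<mu>)"
      using add by simp
    also have "\<dots> = up_ring.monom (UP R) (f i \<otimes> (\<Otimes>j\<in>set_mset \<mu>. f j [^] count \<mu> j)) (1 + size \<mu>)"
      using add.prems by (intro U.monom_mult[symmetric] finprod_closed) auto
    also have "f i \<otimes> (\<Otimes>j\<in>set_mset \<mu>. f j [^] count \<mu> j) =
        (\<Otimes>j\<in>set_mset (add_mset i \<mu>). f j [^] count (add_mset i \<mu>) j)"
      using add.prems by (intro finprod_add_mset[symmetric]) auto
    finally show ?case by simp
  qed
qed

text \<open>The powers of \<open>t\<close> record the degrees: the coefficient of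
  \<open>rees_hom R f F\<close> at the \<open>d\<close>-th power of \<open>t\<close> is the
  homogeneous component of \<open>F\<close> of degree \<open>d\<close>, evaluated at
  \<open>f\<close>.\<close>

lemma rees_hom_zero_component:
  assumes F: "F \<in> carrier (mpoly_ring R m)" and f: "f \<in> {..<m} \<rightarrow> carrier R"
    and zero: "rees_hom R f F = \<zero>\<^bsub>UP R\<^esub>"
  shows "(\<Oplus>\<mu>\<in>{\<mu>. F \<mu> \<noteq> \<zero> \<and> size \<mu> = d}. F \<mu> \<otimes> (\<Otimes>j\<in>set_mset \<mu>. f j [^] count \<mu> j)) = \<zero>"
proof -
  interpret U: UP_cring R "UP R" by unfold_locales simp
  let ?c = "\<lambda>\<mu>. F \<mu> \<otimes> (\<Otimes>j\<in>set_mset \<mu>. f j [^] count \<mu> j)"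
  note supp = mpoly_ring_support[OF F]
  have fm: "f \<in> set_mset \<mu> \<rightarrow> carrier R" if "F \<mu> \<noteq> \<zero>" for \<mu>
    using supp that f by (auto simp: Pi_iff)
  have c: "?c \<mu> \<in> carrier R" if "F \<mu> \<noteq> \<zero>" for \<mu>
    using fm[OF that] mpoly_ring_coeff[OF F] by (intro m_closed finprod_closed) auto
  have "rees_hom R f F = (\<Oplus>\<^bsub>UP R\<^esub>\<mu>\<in>{\<mu>. F \<mu> \<noteq> \<zero>}. up_ring.monom (UP R) (?c \<mu>) (size \<mu>))"
    unfolding rees_hom_def
  proof (rule U.P.finsum_cong')
    fix \<mu> assume \<mu>: "\<mu> \<in> {\<mu>. F \<mu> \<noteq> \<zero>}"
    then have "f \<in> set_mset \<mu> \<rightarrow> carrier R" using fm by simp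
    then have "(\<Otimes>j\<in>set_mset \<mu>. f j [^] count \<mu> j) \<in> carrier R" by (intro finprod_closed) auto
    then show "up_ring.monom (UP R) (F \<mu>) 0 \<otimes>\<^bsub>UP R\<^esub>
        (\<Otimes>\<^bsub>UP R\<^esub>j\<in>set_mset \<mu>. up_ring.monom (UP R) (f j) 1 [^]\<^bsub>UP R\<^esub> count \<mu> j) =
        up_ring.monom (UP R) (?c \<mu>) (size \<mu>)"
      using \<mu> mpoly_ring_coeff[OF F] U.monom_mult[of "F \<mu>" "\<Otimes>j\<in>set_mset \<mu>. f j [^] count \<mu> j" 0 "size \<mu>"]
      by (subst monomial_value_UP[OF fm]) auto
  qed (use c in auto)
  then have "\<zero> = up_ring.coeff (UP R) (\<Oplus>\<^bsub>UP R\<^esub>\<mu>\<in>{\<mu>. F \<mu> \<noteq> \<zero>}. up_ring.monom (UP R) (?c \<mu>) (size \<mu>)) d"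
    using zero U.coeff_zero[of d] by metis
  also have "\<dots> = (\<Oplus>\<mu>\<in>{\<mu>. F \<mu> \<noteq> \<zero>}. up_ring.coeff (UP R) (up_ring.monom (UP R) (?c \<mu>) (size \<mu>)) d)"
    using supp c by (intro U.coeff_finsum) auto
  also have "\<dots> = (\<Oplus>\<mu>\<in>{\<mu>. F \<mu> \<noteq> \<zero>}. if size \<mu> = d then ?c \<mu> else \<zero>)"
    using c by (intro finsum_cong') auto
  also have "\<dots> = (\<Oplus>\<mu>\<in>{\<mu>. F \<mu> \<noteq> \<zero> \<and> size \<mu> = d}. ?c \<mu>)"
    using supp c by (intro add.finprod_mono_neutral_cong_right) auto
  finally show ?thesis by simp
qed

end

text \<open>The relation \<open>rel\<close> trades a factor \<open>G\<close> and a variable for a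
  scalar \<open>f j\<close> and a factor \<open>H\<close>. After multiplication by a large power of
  \<open>G\<close>, every component of \<open>F\<close> becomes its value at \<open>f\<close> times
  a fixed element, and this value is zero. The ring \<open>S\<close> is kept general; later it is
  the quotient by the linear relations.\<close>

lemma (in ring_hom_cring) kernel_power_vanish:
  fixes f :: "nat \<Rightarrow> 'a" and G H and q :: "(nat multiset \<Rightarrow> 'a) \<Rightarrow> 'c"
  assumes q: "ring_hom_cring (mpoly_ring R m) S q"
    and h: "\<And>a. a \<in> carrier R \<Longrightarrow> h a = q (ring.indexed_const R a)"
    and f: "f \<in> {..<m} \<rightarrow> carrier R" and G: "G \<in> carrier S" and H: "H \<in> carrier S"
    and rel: "\<And>j. j < m \<Longrightarrow> G \<otimes>\<^bsub>S\<^esub> q (ring.indexed_var R j) = h (f j) \<otimes>\<^bsub>S\<^esub> H"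
    and F: "F \<in> rees_ideal R m f"
  shows "\<exists>N::nat. G [^]\<^bsub>S\<^esub> N \<otimes>\<^bsub>S\<^esub> q F = \<zero>\<^bsub>S\<^esub>"
proof -
  interpret T: cring "mpoly_ring R m" by (rule R.mpoly_ring_cring)
  interpret q: ring_hom_cring "mpoly_ring R m" S q by fact
  let ?v = "\<lambda>\<mu>. \<Otimes>j\<in>set_mset \<mu>. f j [^] count \<mu> j"
  have FT: "F \<in> carrier (mpoly_ring R m)" and F0: "rees_hom R f F = \<zero>\<^bsub>UP R\<^esub>"
    using F by (auto simp: rees_ideal_def a_kernel_def' rees_algebra_def)
  have v: "?v \<mu> \<in> carrier R" if "set_mset \<mu> \<subseteq> {..<m}" for \<mu>
    using that f by (intro R.finprod_closed) (auto simp: Pi_iff)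
  have monom_rel: "G [^]\<^bsub>S\<^esub> size \<mu> \<otimes>\<^bsub>S\<^esub> q (R.indexed_monom \<mu>) = h (?v \<mu>) \<otimes>\<^bsub>S\<^esub> H [^]\<^bsub>S\<^esub> size \<mu>"
    if "set_mset \<mu> \<subseteq> {..<m}" for \<mu>
    using that
  proof (induction \<mu>)
    case empty
    have "q (R.indexed_const \<one>) = \<one>\<^bsub>S\<^esub>" using h[of \<one>] by simp
    then show ?case by (simp add: R.indexed_monom_empty)
  next
    case (add i \<mu>)
    then have i: "i < m" and \<mu>: "set_mset \<mu> \<subseteq> {..<m}" by auto
    let ?w = "G [^]\<^bsub>S\<^esub> size \<mu>" and ?y = "q (R.indexed_var i)" and ?M = "q (R.indexed_monom \<mu>)"
    have M: "R.indexed_monom \<mu> \<in> carrier (mpoly_ring R m)"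
      using \<mu> by (rule R.indexed_monom_in_mpoly_ring)
    have fi: "f i \<in> carrier R" using f i by auto
    have "q (R.indexed_monom (add_mset i \<mu>)) = ?y \<otimes>\<^bsub>S\<^esub> ?M"
      using i M by (simp add: R.indexed_monom_add_mset R.var_mult[symmetric])
    then have "G [^]\<^bsub>S\<^esub> size (add_mset i \<mu>) \<otimes>\<^bsub>S\<^esub> q (R.indexed_monom (add_mset i \<mu>)) =
        (G \<otimes>\<^bsub>S\<^esub> ?y) \<otimes>\<^bsub>S\<^esub> (?w \<otimes>\<^bsub>S\<^esub> ?M)"
      using G M i by (simp add: S.m_ac)
    also have "\<dots> = (h (f i) \<otimes>\<^bsub>S\<^esub> H) \<otimes>\<^bsub>S\<^esub> (h (?v \<mu>) \<otimes>\<^bsub>S\<^esub> H [^]\<^bsub>S\<^esub> size \<mu>)"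
      using add.IH[OF \<mu>] rel[OF i] by simp
    also have "\<dots> = h (f i \<otimes> ?v \<mu>) \<otimes>\<^bsub>S\<^esub> H [^]\<^bsub>S\<^esub> size (add_mset i \<mu>)"
      using H fi v[OF \<mu>] by (simp add: S.m_ac)
    also have "f i \<otimes> ?v \<mu> = ?v (add_mset i \<mu>)"
      using add.prems f by (intro R.finprod_add_mset[symmetric]) (auto simp: Pi_iff)
    finally show ?case .
  qed
  let ?A = "{\<mu>. F \<mu> \<noteq> \<zero>}" and ?A' = "\<lambda>d. {\<mu>. F \<mu> \<noteq> \<zero> \<and> size \<mu> = d}"
  note supp = R.mpoly_ring_support[OF FT] and Fc = R.mpoly_ring_coeff[OF FT]
  \<comment> \<open>For \<open>F\<close> zero this is the unspecified maximum of the empty set. Only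
    the bound on the sizes of monomials in the support is used, and it is then vacuous.\<close>
  define N where "N = Max (size ` ?A)"
  have N: "size \<mu> \<le> N" if "F \<mu> \<noteq> \<zero>" for \<mu>
    unfolding N_def using that supp by (intro Max_ge) auto
  have M: "R.indexed_monom \<mu> \<in> carrier (mpoly_ring R m)" if "F \<mu> \<noteq> \<zero>" for \<mu>
    using that supp by (intro R.indexed_monom_in_mpoly_ring) auto
  \<comment> \<open>What remains of the powers of \<open>G\<close> and \<open>H\<close> after a
    monomial of degree \<open>d\<close> has been rewritten. It depends on \<open>d\<close> alone and
    so can be pulled out of the sum over all monomials of that degree.\<close>
  let ?e = "\<lambda>d. G [^]\<^bsub>S\<^esub> (N - d) \<otimes>\<^bsub>S\<^esub> H [^]\<^bsub>S\<^esub> d"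
  have e: "?e d \<in> carrier S" for d using G H by simp
  have c: "F \<mu> \<otimes> ?v \<mu> \<in> carrier R" if "F \<mu> \<noteq> \<zero>" for \<mu>
    using that supp v Fc by simp
  have term_rel: "G [^]\<^bsub>S\<^esub> N \<otimes>\<^bsub>S\<^esub> q (R.indexed_const (F \<mu>) \<otimes>\<^bsub>mpoly_ring R m\<^esub> R.indexed_monom \<mu>) =
      h (F \<mu> \<otimes> ?v \<mu>) \<otimes>\<^bsub>S\<^esub> ?e (size \<mu>)" if \<mu>: "F \<mu> \<noteq> \<zero>" for \<mu>
  proof -
    have "G [^]\<^bsub>S\<^esub> N = G [^]\<^bsub>S\<^esub> (N - size \<mu>) \<otimes>\<^bsub>S\<^esub> G [^]\<^bsub>S\<^esub> size \<mu>"
      using N[OF \<mu>] G by (simp add: S.nat_pow_mult)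
    moreover have "q (R.indexed_const (F \<mu>) \<otimes>\<^bsub>mpoly_ring R m\<^esub> R.indexed_monom \<mu>) =
        h (F \<mu>) \<otimes>\<^bsub>S\<^esub> q (R.indexed_monom \<mu>)"
      using M[OF \<mu>] Fc h by simp
    ultimately have "G [^]\<^bsub>S\<^esub> N \<otimes>\<^bsub>S\<^esub> q (R.indexed_const (F \<mu>) \<otimes>\<^bsub>mpoly_ring R m\<^esub> R.indexed_monom \<mu>) =
        h (F \<mu>) \<otimes>\<^bsub>S\<^esub> G [^]\<^bsub>S\<^esub> (N - size \<mu>) \<otimes>\<^bsub>S\<^esub> (G [^]\<^bsub>S\<^esub> size \<mu> \<otimes>\<^bsub>S\<^esub> q (R.indexed_monom \<mu>))"
      using M[OF \<mu>] Fc G by (simp add: S.m_ac)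
    also have "\<dots> = h (F \<mu>) \<otimes>\<^bsub>S\<^esub> G [^]\<^bsub>S\<^esub> (N - size \<mu>) \<otimes>\<^bsub>S\<^esub> (h (?v \<mu>) \<otimes>\<^bsub>S\<^esub> H [^]\<^bsub>S\<^esub> size \<mu>)"
      using supp \<mu> by (subst monom_rel) auto
    also have "\<dots> = h (F \<mu> \<otimes> ?v \<mu>) \<otimes>\<^bsub>S\<^esub> ?e (size \<mu>)"
      using G H Fc v supp \<mu> by (simp add: S.m_ac)
    finally show ?thesis .
  qed
  have qF: "q F = (\<Oplus>\<^bsub>S\<^esub>\<mu>\<in>?A. q (R.indexed_const (F \<mu>) \<otimes>\<^bsub>mpoly_ring R m\<^esub> R.indexed_monom \<mu>))"
    using Fc M by (subst R.mpoly_ring_decomp[OF FT]) (subst q.hom_finsum, auto simp: o_def)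
  have "G [^]\<^bsub>S\<^esub> N \<otimes>\<^bsub>S\<^esub> q F =
      (\<Oplus>\<^bsub>S\<^esub>\<mu>\<in>?A. G [^]\<^bsub>S\<^esub> N \<otimes>\<^bsub>S\<^esub> q (R.indexed_const (F \<mu>) \<otimes>\<^bsub>mpoly_ring R m\<^esub> R.indexed_monom \<mu>))"
    unfolding qF using G Fc M supp by (intro S.finsum_rdistr) auto
  also have "\<dots> = (\<Oplus>\<^bsub>S\<^esub>\<mu>\<in>?A. h (F \<mu> \<otimes> ?v \<mu>) \<otimes>\<^bsub>S\<^esub> ?e (size \<mu>))"
    using term_rel c e by (intro S.finsum_cong') (auto simp del: hom_mult)
  \<comment> \<open>Grouping the support by degree brings out the components that
    \<open>rees_hom_zero_component\<close> makes vanish.\<close>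
  also have "?A = (\<Union>d\<in>{..N}. ?A' d)"
    using N by auto
  also have "(\<Oplus>\<^bsub>S\<^esub>\<mu>\<in>(\<Union>d\<in>{..N}. ?A' d). h (F \<mu> \<otimes> ?v \<mu>) \<otimes>\<^bsub>S\<^esub> ?e (size \<mu>)) =
      (\<Oplus>\<^bsub>S\<^esub>d\<in>{..N}. \<Oplus>\<^bsub>S\<^esub>\<mu>\<in>?A' d. h (F \<mu> \<otimes> ?v \<mu>) \<otimes>\<^bsub>S\<^esub> ?e (size \<mu>))"
    using supp c e by (intro S.add.finprod_UN_disjoint) (auto simp: pairwise_def disjnt_def simp del: hom_mult)
  also have "\<dots> = \<zero>\<^bsub>S\<^esub>"
  proof (rule S.add.finprod_one_eqI)
    fix d
    have "(\<Oplus>\<^bsub>S\<^esub>\<mu>\<in>?A' d. h (F \<mu> \<otimes> ?v \<mu>) \<otimes>\<^bsub>S\<^esub> ?e (size \<mu>)) =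
        (\<Oplus>\<^bsub>S\<^esub>\<mu>\<in>?A' d. h (F \<mu> \<otimes> ?v \<mu>) \<otimes>\<^bsub>S\<^esub> ?e d)"
      using c e by (intro S.finsum_cong') (auto simp del: hom_mult)
    also have "\<dots> = (\<Oplus>\<^bsub>S\<^esub>\<mu>\<in>?A' d. h (F \<mu> \<otimes> ?v \<mu>)) \<otimes>\<^bsub>S\<^esub> ?e d"
      using c e supp by (intro S.finsum_ldistr[symmetric]) (auto simp del: hom_mult)
    also have "(\<Oplus>\<^bsub>S\<^esub>\<mu>\<in>?A' d. h (F \<mu> \<otimes> ?v \<mu>)) = h (\<Oplus>\<mu>\<in>?A' d. F \<mu> \<otimes> ?v \<mu>)"
      using c by (subst hom_finsum) (auto simp: o_def simp del: hom_mult)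
    also have "\<dots> = \<zero>\<^bsub>S\<^esub>" by (simp add: R.rees_hom_zero_component[OF FT f F0])
    finally show "(\<Oplus>\<^bsub>S\<^esub>\<mu>\<in>?A' d. h (F \<mu> \<otimes> ?v \<mu>) \<otimes>\<^bsub>S\<^esub> ?e (size \<mu>)) = \<zero>\<^bsub>S\<^esub>"
      using e[of d] by simp
  qed
  finally show ?thesis by blast
qed

lemma (in ideal) rcos_eq_zero_iff:
  "x \<in> carrier R \<Longrightarrow> I +> x = \<zero>\<^bsub>R Quot I\<^esub> \<longleftrightarrow> x \<in> I"
  using a_rcos_zero[OF ideal_axioms] rcos_const_imp_mem by (auto simp: FactRing_def)

context cring
begin

section \<open>Linear relations and the conductor\<close>

lemma linear_relations_ideal:
  assumes "f \<in> {..<m} \<rightarrow> carrier R"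
  shows "ideal (linear_relations_ideal R m f) (mpoly_ring R m)"
proof -
  interpret T: cring "mpoly_ring R m" by (rule mpoly_ring_cring)
  show ?thesis
    unfolding linear_relations_ideal_def
    by (rule T.genideal_ideal) (auto intro!: T.finsum_closed T.m_closed simp: Pi_iff)
qed

text \<open>The coefficients are \<open>f k\<close> at position \<open>j\<close> and minus
  \<open>f j\<close> at position \<open>k\<close>; evaluated at \<open>f\<close> they cancel by
  commutativity. For \<open>j = k\<close> they already add up to zero.\<close>

lemma koszul_relation_in_linear_relations_ideal:
  assumes f: "f \<in> {..<m} \<rightarrow> carrier R" and j: "j < m" and k: "k < m"
  shows "indexed_const (f k) \<otimes>\<^bsub>mpoly_ring R m\<^esub> indexed_var j \<oplus>\<^bsub>mpoly_ring R m\<^esub>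
    indexed_const (\<ominus> f j) \<otimes>\<^bsub>mpoly_ring R m\<^esub> indexed_var k \<in> linear_relations_ideal R m f"
proof -
  interpret C: ring_hom_cring R "mpoly_ring R m" indexed_const by (rule indexed_const_hom)
  have id: "ring_hom_cring R R (\<lambda>x. x)"
    by unfold_locales (auto simp: ring_hom_def)
  let ?a = "\<lambda>i. (if j = i then f k else \<zero>) \<oplus> (if k = i then \<ominus> f j else \<zero>)"
  have fc: "f j \<in> carrier R" "f k \<in> carrier R" using f j k by auto
  have eq: "(\<Oplus>\<^bsub>mpoly_ring R m\<^esub>i\<in>{..<m}. indexed_const (?a i) \<otimes>\<^bsub>mpoly_ring R m\<^esub> indexed_var i) =
      indexed_const (f k) \<otimes>\<^bsub>mpoly_ring R m\<^esub> indexed_var j \<oplus>\<^bsub>mpoly_ring R m\<^esub>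
      indexed_const (\<ominus> f j) \<otimes>\<^bsub>mpoly_ring R m\<^esub> indexed_var k"
    using fc j k by (intro C.finsum_two_terms[of _ j k "f k" "\<ominus> f j" indexed_var]) auto
  have "(\<Oplus>i\<in>{..<m}. ?a i \<otimes> f i) = f k \<otimes> f j \<oplus> (\<ominus> f j) \<otimes> f k"
    using fc j k f by (intro ring_hom_cring.finsum_two_terms[OF id, of _ j k "f k" "\<ominus> f j" f]) auto
  also have "\<dots> = \<zero>" using fc by (simp add: l_minus m_comm[of "f k" "f j"] r_neg)
  finally have rel: "(\<Oplus>i\<in>{..<m}. ?a i \<otimes> f i) = \<zero>" .
  have a: "?a \<in> {..<m} \<rightarrow> carrier R" using fc by auto
  have "(\<Oplus>\<^bsub>mpoly_ring R m\<^esub>i\<in>{..<m}. indexed_const (?a i) \<otimes>\<^bsub>mpoly_ring R m\<^esub> indexed_var i)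
      \<in> linear_relations_ideal R m f"
    unfolding linear_relations_ideal_def
  proof (rule subsetD[OF C.S.genideal_self])
    show "(\<Oplus>\<^bsub>mpoly_ring R m\<^esub>i\<in>{..<m}. indexed_const (?a i) \<otimes>\<^bsub>mpoly_ring R m\<^esub> indexed_var i) \<in>
        {\<Oplus>\<^bsub>mpoly_ring R m\<^esub>i\<in>{..<m}. indexed_const (a i) \<otimes>\<^bsub>mpoly_ring R m\<^esub> indexed_var i |a.
          a \<in> {..<m} \<rightarrow> carrier R \<and> (\<Oplus>i\<in>{..<m}. a i \<otimes> f i) = \<zero>}"
      using a rel by (intro CollectI exI[of _ ?a] conjI refl)
  qed (auto intro!: C.S.finsum_closed C.S.m_closed simp: Pi_iff)
  then show ?thesis unfolding eq .
qed

text \<open>The computation takes place in \<open>A\<close>, the symmetric algebra of the ideal.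
  There \<open>kernel_power_vanish\<close> gives an exponent for each \<open>F\<close> separately,
  and \<open>colon_powers_stabilize\<close> in the Noetherian ring \<open>T\<close> makes it
  uniform.\<close>

lemma genideal_power_in_conductor:
  assumes noeth: "noetherian_ring R" and f: "f \<in> {..<m} \<rightarrow> carrier R"
    and g: "g \<in> Idl (f ` {..<m})"
  shows "\<exists>N::nat. g [^] N \<in> conductor R m f"
proof -
  define T L A where "T = mpoly_ring R m" and "L = linear_relations_ideal R m f" and "A = T Quot L"
  interpret T: noetherian_ring T
    unfolding T_def by (rule noetherian_mpoly_ring[OF noeth])
  interpret C: ring_hom_cring R T indexed_const
    unfolding T_def by (rule indexed_const_hom)
  interpret L: ideal L T
    unfolding L_def T_def by (rule linear_relations_ideal[OF f])
  define q where "q = (\<lambda>F. L +>\<^bsub>T\<^esub> F)"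
  interpret q: ring_hom_cring T A q
    unfolding q_def A_def using L.rcos_ring_hom_cring[OF C.S.is_cring] by (simp add: eta_contract_eq)
  have C_ring: "ring_hom_ring R T indexed_const" and q_ring: "ring_hom_ring T A q"
    by (rule ring_hom_ringI2; unfold_locales; fact C.homh q.homh)+
  have q_zero: "q F = \<zero>\<^bsub>A\<^esub> \<longleftrightarrow> F \<in> L" if "F \<in> carrier T" for F
    using L.rcos_eq_zero_iff[OF that] by (simp add: q_def A_def)
  define h where "h = q \<circ> indexed_const"
  interpret h: ring_hom_cring R A h
    unfolding h_def
    by unfold_locales (rule ring_hom_trans[OF C.homh q.homh])
  have var: "indexed_var j \<in> carrier T" if "j < m" for j
    using that by (simp add: T_def)
  have Y: "(\<lambda>j. q (indexed_var j)) \<in> {..<m} \<rightarrow> carrier A" using var by auto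
  let ?P = "{g \<in> carrier R. \<exists>H \<in> carrier A. \<forall>j \<in> {..<m}.
    h g \<otimes>\<^bsub>A\<^esub> q (indexed_var j) = h (f j) \<otimes>\<^bsub>A\<^esub> H}"
  \<comment> \<open>For the generator \<open>f k\<close> the witness is the class of the variable
    with index \<open>k\<close>, by the Koszul relations. For general \<open>g\<close>, the
    \<open>H\<close> obtained this way plays the part of the linear form with value \<open>g\<close>
    at \<open>f\<close>.\<close>
  have "Idl (f ` {..<m}) \<subseteq> ?P"
  proof (rule genideal_minimal[OF h.ideal_proportional[OF f Y]], clarsimp)
    fix k assume k: "k < m"
    have fk: "f k \<in> carrier R" using f k by auto
    have "h (f k) \<otimes>\<^bsub>A\<^esub> q (indexed_var j) = h (f j) \<otimes>\<^bsub>A\<^esub> q (indexed_var k)" if j: "j < m" for j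
    proof -
      have fj: "f j \<in> carrier R" using f j by auto
      have "indexed_const (f k) \<otimes>\<^bsub>T\<^esub> indexed_var j \<oplus>\<^bsub>T\<^esub> indexed_const (\<ominus> f j) \<otimes>\<^bsub>T\<^esub> indexed_var k \<in> L"
        unfolding T_def L_def by (rule koszul_relation_in_linear_relations_ideal[OF f j k])
      then have "q (indexed_const (f k) \<otimes>\<^bsub>T\<^esub> indexed_var j \<oplus>\<^bsub>T\<^esub>
          indexed_const (\<ominus> f j) \<otimes>\<^bsub>T\<^esub> indexed_var k) = \<zero>\<^bsub>A\<^esub>"
        using q_zero L.Icarr by blast
      then have "h (f k) \<otimes>\<^bsub>A\<^esub> q (indexed_var j) \<oplus>\<^bsub>A\<^esub> h (\<ominus> f j) \<otimes>\<^bsub>A\<^esub> q (indexed_var k) = \<zero>\<^bsub>A\<^esub>"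
        using fj fk var[OF j] var[OF k] by (simp add: h_def del: C.hom_a_inv h.hom_a_inv)
      then have "h (f k) \<otimes>\<^bsub>A\<^esub> q (indexed_var j) \<oplus>\<^bsub>A\<^esub> \<ominus>\<^bsub>A\<^esub> (h (f j) \<otimes>\<^bsub>A\<^esub> q (indexed_var k)) = \<zero>\<^bsub>A\<^esub>"
        using fj var[OF k] by (simp add: q.S.l_minus)
      then show ?thesis
        using q.S.r_right_minus_eq[of "h (f k) \<otimes>\<^bsub>A\<^esub> q (indexed_var j)" "h (f j) \<otimes>\<^bsub>A\<^esub> q (indexed_var k)"]
          fj fk var[OF j] var[OF k] by (simp add: q.S.minus_eq)
    qed
    then show "f k \<in> carrier R \<and> (\<exists>H\<in>carrier A. \<forall>j\<in>{..<m}.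
        h (f k) \<otimes>\<^bsub>A\<^esub> q (indexed_var j) = h (f j) \<otimes>\<^bsub>A\<^esub> H)"
      using fk var[OF k] by auto
  qed
  then obtain H where g_carr: "g \<in> carrier R" and H: "H \<in> carrier A"
      "\<And>j. j < m \<Longrightarrow> h g \<otimes>\<^bsub>A\<^esub> q (indexed_var j) = h (f j) \<otimes>\<^bsub>A\<^esub> H"
    using g by auto
  \<comment> \<open>The exponent is fixed before any \<open>F\<close> is chosen, as membership in
    the conductor demands.\<close>
  obtain N :: nat where N: "\<And>F k. F \<in> carrier T \<Longrightarrow>
      indexed_const g [^]\<^bsub>T\<^esub> (k::nat) \<otimes>\<^bsub>T\<^esub> F \<in> L \<Longrightarrow> indexed_const g [^]\<^bsub>T\<^esub> N \<otimes>\<^bsub>T\<^esub> F \<in> L"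
    using T.colon_powers_stabilize[OF C.S.is_cring L.ideal_axioms, of "indexed_const g"] g_carr by auto
  have "indexed_const (g [^] N) \<otimes>\<^bsub>T\<^esub> F \<in> L" if F: "F \<in> rees_ideal R m f" for F
  proof -
    have FT: "F \<in> carrier T" using F by (simp add: rees_ideal_def a_kernel_def' T_def)
    obtain k :: nat where k: "h g [^]\<^bsub>A\<^esub> k \<otimes>\<^bsub>A\<^esub> q F = \<zero>\<^bsub>A\<^esub>"
      using h.kernel_power_vanish[OF q.ring_hom_cring_axioms[unfolded T_def] _ f _ H(1) H(2) F] g_carr
      by (auto simp: h_def)
    \<comment> \<open>Vanishing in the quotient is turned back into membership in \<open>L\<close>,
      where the exponent \<open>k\<close>, which depends on \<open>F\<close>, can be replaced by
      \<open>N\<close>.\<close>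
    have "q (indexed_const g [^]\<^bsub>T\<^esub> k \<otimes>\<^bsub>T\<^esub> F) = \<zero>\<^bsub>A\<^esub>"
      using k g_carr FT by (simp add: h_def ring_hom_ring.hom_nat_pow[OF q_ring])
    then have "indexed_const g [^]\<^bsub>T\<^esub> k \<otimes>\<^bsub>T\<^esub> F \<in> L"
      using g_carr FT by (subst (asm) q_zero) auto
    then show ?thesis using N[OF FT] g_carr by (simp add: ring_hom_ring.hom_nat_pow[OF C_ring])
  qed
  then have "g [^] N \<in> conductor R m f"
    using g_carr by (simp add: conductor_def T_def L_def)
  then show ?thesis by blast
qed

end

theorem corollary1p4:
  fixes R :: "('a, 'b) ring_scheme" (structure)
    and I :: "'a set" and m :: nat and f :: "nat \<Rightarrow> 'a"
  assumes "cring R" and "noetherian_ring R" and "ideal I R"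
    and "f \<in> {..<m} \<rightarrow> carrier R" and "I = Idl\<^bsub>R\<^esub> (f ` {..<m})"
  shows "radical R I \<subseteq> radical R (conductor R m f)"
proof
  interpret cring R by fact
  fix x assume "x \<in> radical R I"
  then obtain n :: nat where x: "x \<in> carrier R" "x [^] n \<in> I" by (auto simp: radical_def)
  \<comment> \<open>The preceding lemma is applied to the power of \<open>x\<close> that lies in
    \<open>I\<close>. The exponents multiply, and since \<open>radical\<close> admits exponent 0 no
    positivity has to be checked.\<close>
  then obtain N :: nat where "(x [^] n) [^] N \<in> conductor R m f"
    using genideal_power_in_conductor assms by blast
  then show "x \<in> radical R (conductor R m f)"
    using x by (auto simp: radical_def nat_pow_pow)
qed

end
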